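(* Let $G$ be a soluble group of finite rank. If $\omega(G) < \infty$, then $G$ has a torsion-free radicable nilpotent subgroup $K$ such that $G = K \rtimes H$, where $H$ is a finite subgroup of $G$.
   Context: For a group $G$, $\omega(G)$ denotes the number of orbits of the natural action of the automorphism group $\mathrm{Aut}(G)$ on $G$. A group $G$ has finite rank $r$ (for a positive integer $r$) if each finitely generated subgroup of $G$ can be generated by $r$ or fewer elements and $r$ is the least such integer. A group is radicable if each of its elements is an $n$th power (of an element of the group) for every positive integer $n$. Writing $G = K \rtimes H$ for subgroups $K, H$ of $G$ means that $K$ is normal in $G$, $K \cap H = 1$ and $G = KH$. *)

theory Defs
  imports "HOL-Algebra.Algebra"
begin

definition aut_orbits :: "('a, 'b) monoid_scheme \<Rightarrow> 'a set set" where
  "aut_orbits G = orbits (AutoGroup G) (carrier G) (\<lambda>f. f)"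

definition fg_subgroups_generated_by :: "('a, 'b) monoid_scheme \<Rightarrow> nat \<Rightarrow> bool" where
  "fg_subgroups_generated_by G r \<longleftrightarrow>
     (\<forall>S. finite S \<and> S \<subseteq> carrier G \<longrightarrow>
        (\<exists>T. finite T \<and> T \<subseteq> carrier G \<and> card T \<le> r \<and> generate G T = generate G S))"

(* The rank is a positive integer by convention, so the trivial group has rank 1. *)
definition has_rank :: "('a, 'b) monoid_scheme \<Rightarrow> nat \<Rightarrow> bool" where
  "has_rank G r \<longleftrightarrow>
     0 < r \<and> fg_subgroups_generated_by G r \<and>
     (\<forall>s. 0 < s \<and> fg_subgroups_generated_by G s \<longrightarrow> r \<le> s)"

definition finite_rank :: "('a, 'b) monoid_scheme \<Rightarrow> bool" where
  "finite_rank G \<longleftrightarrow> (\<exists>r. has_rank G r)"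

definition radicable :: "('a, 'b) monoid_scheme \<Rightarrow> bool" where
  "radicable G \<longleftrightarrow>
     (\<forall>x \<in> carrier G. \<forall>n::nat. 0 < n \<longrightarrow> (\<exists>y \<in> carrier G. y [^]\<^bsub>G\<^esub> n = x))"

definition torsion_free :: "('a, 'b) monoid_scheme \<Rightarrow> bool" where
  "torsion_free G \<longleftrightarrow>
     (\<forall>x \<in> carrier G. \<forall>n::nat. 0 < n \<and> x [^]\<^bsub>G\<^esub> n = \<one>\<^bsub>G\<^esub> \<longrightarrow> x = \<one>\<^bsub>G\<^esub>)"

definition commutator_subgroup :: "('a, 'b) monoid_scheme \<Rightarrow> 'a set \<Rightarrow> 'a set \<Rightarrow> 'a set" where
  "commutator_subgroup G A B =
     generate G (\<Union>a \<in> A. \<Union>b \<in> B. {a \<otimes>\<^bsub>G\<^esub> b \<otimes>\<^bsub>G\<^esub> inv\<^bsub>G\<^esub> a \<otimes>\<^bsub>G\<^esub> inv\<^bsub>G\<^esub> b})"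

primrec lower_central :: "('a, 'b) monoid_scheme \<Rightarrow> nat \<Rightarrow> 'a set" where
  "lower_central G 0 = carrier G"
| "lower_central G (Suc n) = commutator_subgroup G (lower_central G n) (carrier G)"

definition nilpotent_group :: "('a, 'b) monoid_scheme \<Rightarrow> bool" where
  "nilpotent_group G \<longleftrightarrow> (\<exists>n. lower_central G n = {\<one>\<^bsub>G\<^esub>})"

definition internal_semidirect :: "('a, 'b) monoid_scheme \<Rightarrow> 'a set \<Rightarrow> 'a set \<Rightarrow> bool" where
  "internal_semidirect G K H \<longleftrightarrow>
     K \<lhd> G \<and> subgroup H G \<and> K \<inter> H = {\<one>\<^bsub>G\<^esub>} \<and> carrier G = K <#>\<^bsub>G\<^esub> H"

end

theory Submission
  imports Defs "HOL-Computational_Algebra.Polynomial"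
begin

text \<open>
  Characteristic subgroups are unions of orbits, so there are only finitely many of them; let
  \<open>R\<close> be the least one of finite index. A characteristic section of bounded exponent is finite,
  so \<open>R\<close> centralizes it, and \<open>R\<close> is generated by its \<open>n\<close>-th powers for every \<open>n > 0\<close>.

  If the lower central series of \<open>R\<close> stopped at \<open>L \<noteq> 1\<close>, choose \<open>M\<close> maximal among the proper
  characteristic subgroups of \<open>L\<close> containing \<open>[L, L]\<close>. If \<open>L/M\<close> has bounded exponent, then
  \<open>[L, R] \<subseteq> M\<close>. Otherwise \<open>L/M\<close> is torsion-free of finite rank, and as the polynomials
  annihilating the action of \<open>x\<close> depend only on the orbit of \<open>x\<close>, a single \<open>f \<noteq> 0\<close> annihilates
  the action of every element. Evaluating \<open>f\<close> at the powers of \<open>x\<close> on a minimal isolated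
  invariant subgroup, where annihilators are prime ideals, shows that bounded powers of an abelian
  characteristic group of operators have a common fixed point, hence act trivially by the choice
  of \<open>M\<close>. With solubility this forces \<open>R\<close> to act trivially, again \<open>[L, R] \<subseteq> M\<close>; in both cases
  \<open>L = [L, R] \<subseteq> M\<close>, a contradiction. So \<open>R\<close> is nilpotent.

  The factors of the lower central series of \<open>R\<close> are divisible because \<open>R\<close> is generated by
  \<open>n\<close>-th powers, so \<open>R\<close> is radicable. As orders of torsion elements are bounded, roots of torsion
  elements show that \<open>R\<close> is torsion-free modulo every characteristic subgroup. The complement is
  obtained by splitting off one uniquely divisible factor of the lower central series at a time.
\<close>

section \<open>Integer polynomials acting on an abelian group\<close>

text \<open>For an abelian group, written multiplicatively, and an endomorphism this is Horner
  evaluation of \<open>p(\<phi>)\<close> at \<open>a\<close>: the group becomes a module over the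
  integer polynomials, the variable acting as \<open>\<phi>\<close>.\<close>

definition poly_act :: "('a,'b) monoid_scheme \<Rightarrow> ('a \<Rightarrow> 'a) \<Rightarrow> int poly \<Rightarrow> 'a \<Rightarrow> 'a" where
  "poly_act A \<phi> p a = fold_coeffs (\<lambda>c b. a [^]\<^bsub>A\<^esub> c \<otimes>\<^bsub>A\<^esub> \<phi> b) p \<one>\<^bsub>A\<^esub>"

lemma poly_act_0 [simp]: "poly_act A \<phi> 0 a = \<one>\<^bsub>A\<^esub>"
  by (simp add: poly_act_def)

context group
begin

lemma endo_closed: "\<phi> \<in> hom G G \<Longrightarrow> a \<in> carrier G \<Longrightarrow> \<phi> a \<in> carrier G"
  by (auto simp: hom_def)

lemma endo_mult: "\<phi> \<in> hom G G \<Longrightarrow> a \<in> carrier G \<Longrightarrow> b \<in> carrier G \<Longrightarrow> \<phi> (a \<otimes> b) = \<phi> a \<otimes> \<phi> b"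
  by (auto simp: hom_def)

lemma endo_funpow:
  assumes "\<phi> \<in> hom G G"
  shows "\<phi> ^^ k \<in> hom G G"
proof (induction k)
  case (Suc k)
  then show ?case using assms by (auto simp: hom_def Pi_iff)
qed (auto simp: hom_def)

lemma endo_one: "\<phi> \<in> hom G G \<Longrightarrow> \<phi> \<one> = \<one>"
  by (rule hom_one) auto

lemma poly_act_pCons:
  assumes "\<phi> \<in> hom G G" "a \<in> carrier G"
  shows "poly_act G \<phi> (pCons c p) a = a [^] c \<otimes> \<phi> (poly_act G \<phi> p a)"
proof (cases "c = 0 \<and> p = 0")
  case True
  then show ?thesis using endo_one[OF assms(1)] assms by simp
next
  case False
  then show ?thesis
    unfolding poly_act_def
    by (cases "c = 0") (auto simp: fold_coeffs_pCons_not_0_0_eq fold_coeffs_pCons_coeff_not_0_eq)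
qed

lemma poly_act_closed:
  assumes "\<phi> \<in> hom G G" "a \<in> carrier G"
  shows "poly_act G \<phi> p a \<in> carrier G"
  using assms by (induction p) (auto simp: poly_act_pCons endo_closed)

end

context comm_group
begin

lemma poly_act_add:
  assumes "\<phi> \<in> hom G G" "a \<in> carrier G"
  shows "poly_act G \<phi> (p + q) a = poly_act G \<phi> p a \<otimes> poly_act G \<phi> q a"
proof (induction p q rule: poly_induct2)
  case 0
  show ?case using assms by simp
next
  case (pCons c p d q)
  let ?P = "poly_act G \<phi> p a" and ?Q = "poly_act G \<phi> q a"
  have cl: "\<phi> ?P \<in> carrier G" "\<phi> ?Q \<in> carrier G" "?P \<in> carrier G" "?Q \<in> carrier G"
    using assms by (auto simp: poly_act_closed endo_closed)
  have "poly_act G \<phi> (pCons c p + pCons d q) a = a [^] (c + d) \<otimes> (\<phi> ?P \<otimes> \<phi> ?Q)"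
    using assms cl by (simp add: poly_act_pCons pCons endo_mult)
  also have "\<dots> = (a [^] c \<otimes> \<phi> ?P) \<otimes> (a [^] d \<otimes> \<phi> ?Q)"
    using assms cl by (simp add: int_pow_mult m_ac)
  finally show ?case using assms by (simp add: poly_act_pCons)
qed

lemma poly_act_hom:
  assumes "\<phi> \<in> hom G G"
  shows "poly_act G \<phi> p \<in> hom G G"
proof (induction p)
  case 0
  show ?case by (auto simp: hom_def)
next
  case (pCons c p)
  have "poly_act G \<phi> (pCons c p) (a \<otimes> b) = poly_act G \<phi> (pCons c p) a \<otimes> poly_act G \<phi> (pCons c p) b"
    if "a \<in> carrier G" "b \<in> carrier G" for a b
  proof -
    let ?P = "poly_act G \<phi> p a" and ?Q = "poly_act G \<phi> p b"
    have cl: "\<phi> ?P \<in> carrier G" "\<phi> ?Q \<in> carrier G" "?P \<in> carrier G" "?Q \<in> carrier G"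
      using assms that by (auto simp: poly_act_closed endo_closed)
    have "poly_act G \<phi> p (a \<otimes> b) = ?P \<otimes> ?Q" using pCons that by (auto simp: hom_def)
    then show ?thesis using assms that cl
      by (simp add: poly_act_pCons endo_mult int_pow_mult_distrib[OF m_comm] m_ac)
  qed
  then show ?case using assms by (auto simp: hom_def poly_act_closed)
qed

lemma poly_act_smult:
  assumes "\<phi> \<in> hom G G" "a \<in> carrier G"
  shows "poly_act G \<phi> (smult c p) a = poly_act G \<phi> p a [^] c"
proof (induction p)
  case 0
  show ?case by simp
next
  case (pCons d p)
  let ?P = "poly_act G \<phi> p a"
  have cl: "\<phi> ?P \<in> carrier G" "?P \<in> carrier G"
    using assms by (auto simp: poly_act_closed endo_closed)
  interpret h: group_hom G G \<phi> using assms(1) by unfold_locales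
  have "poly_act G \<phi> (smult c (pCons d p)) a = a [^] (d * c) \<otimes> \<phi> ?P [^] c"
    using assms cl by (simp add: poly_act_pCons pCons h.hom_int_pow mult.commute)
  also have "\<dots> = (a [^] d \<otimes> \<phi> ?P) [^] c"
    using assms cl by (simp add: int_pow_mult_distrib[OF m_comm] int_pow_pow)
  finally show ?case using assms by (simp add: poly_act_pCons)
qed

lemma poly_act_mult:
  assumes "\<phi> \<in> hom G G" "a \<in> carrier G"
  shows "poly_act G \<phi> (p * q) a = poly_act G \<phi> p (poly_act G \<phi> q a)"
proof (induction p)
  case 0
  show ?case by simp
next
  case (pCons c p)
  have "poly_act G \<phi> (pCons c p * q) a = poly_act G \<phi> (smult c q + pCons 0 (p * q)) a"
    by simp
  also have "\<dots> = poly_act G \<phi> q a [^] c \<otimes> \<phi> (poly_act G \<phi> (p * q) a)"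
    using assms by (simp only: poly_act_add poly_act_smult poly_act_pCons)
      (simp add: poly_act_closed endo_closed)
  finally show ?case using assms by (simp add: pCons poly_act_pCons poly_act_closed)
qed

lemma poly_act_const:
  assumes "\<phi> \<in> hom G G" "a \<in> carrier G"
  shows "poly_act G \<phi> [:c:] a = a [^] c"
  using assms by (simp add: poly_act_pCons endo_one)

text \<open>With \<open>q\<close> a power of the variable, this turns the statement that
  \<open>f\<close> annihilates a power of \<open>\<phi>\<close> into one about \<open>f(t^i)\<close>
  acting through \<open>\<phi>\<close> itself.\<close>

lemma poly_act_pcompose:
  assumes "\<phi> \<in> hom G G" "a \<in> carrier G"
  shows "poly_act G \<phi> (pcompose p q) a = poly_act G (poly_act G \<phi> q) p a"
proof (induction p)
  case 0
  show ?case by simp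
next
  case (pCons c p)
  show ?case
    using assms by (simp add: pcompose_pCons poly_act_add poly_act_mult poly_act_pCons pCons
        poly_act_hom endo_one)
qed

text \<open>A map intertwining two operators is linear over the integer polynomials. It is used for
  operators that commute, and for an automorphism carrying conjugation by \<open>y\<close> to
  conjugation by its image.\<close>

lemma poly_act_commute:
  assumes "\<phi> \<in> hom G G" "a \<in> carrier G" "comm_group H" "\<phi>' \<in> hom H H" "\<psi> \<in> hom G H"
    and comm: "\<And>b. b \<in> carrier G \<Longrightarrow> \<psi> (\<phi> b) = \<phi>' (\<psi> b)"
  shows "\<psi> (poly_act G \<phi> p a) = poly_act H \<phi>' p (\<psi> a)"
proof -
  interpret H: comm_group H by fact
  interpret h: group_hom G H \<psi> using assms(5) by unfold_locales
  show ?thesis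
  proof (induction p)
    case 0
    show ?case by simp
  next
    case (pCons c p)
    show ?case using assms
      by (simp add: poly_act_pCons H.poly_act_pCons pCons poly_act_closed endo_closed h.hom_int_pow)
  qed
qed

lemma poly_act_cong:
  assumes "\<phi> \<in> hom G G" "a \<in> carrier G" "\<psi> \<in> hom G G"
    and "\<And>b. b \<in> carrier G \<Longrightarrow> \<phi> b = \<psi> b"
  shows "poly_act G \<phi> p a = poly_act G \<psi> p a"
  using assms by (induction p) (simp_all add: poly_act_pCons poly_act_closed)

lemma poly_act_monom:
  assumes "\<phi> \<in> hom G G" "a \<in> carrier G"
  shows "poly_act G \<phi> (Polynomial.monom c k) a = (\<phi> ^^ k) (a [^] c)"
proof (induction k)
  case 0
  then show ?case using assms by (simp add: monom_0 poly_act_const)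
next
  case (Suc k)
  have "(\<phi> ^^ k) (a [^] c) \<in> carrier G"
    using assms by (induction k) (auto simp: endo_closed)
  with Suc show ?case using assms by (simp add: monom_Suc poly_act_pCons endo_closed)
qed

end

section \<open>Roots of polynomials modulo a prime ideal\<close>

text \<open>Modulo a prime ideal a polynomial with nonzero leading coefficient has at most as many
  roots as its degree, so of one root more than that, two coincide modulo \<open>J\<close>. The
  induction splits off the last root.\<close>

lemma exists_root_diff_in_prime:
  fixes F :: "'r::comm_ring_1 poly"
  assumes diff: "\<And>a b. a \<in> J \<Longrightarrow> b \<in> J \<Longrightarrow> a - b \<in> J"
    and prime: "\<And>a b. a * b \<in> J \<Longrightarrow> a \<in> J \<or> b \<in> J"
    and "Polynomial.lead_coeff F \<notin> J"
    and "\<And>i. i \<le> Polynomial.degree F \<Longrightarrow> poly F (r i) \<in> J"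
  shows "\<exists>i j. i < j \<and> j \<le> Polynomial.degree F \<and> r i - r j \<in> J"
  using assms(3,4)
proof (induction "Polynomial.degree F" arbitrary: F)
  case 0
  then obtain c where "F = [:c:]" by (metis degree_eq_zeroE)
  with 0 show ?case by (metis degree_pCons_0 coeff_pCons_0 le_refl poly_pCons poly_0 mult_zero_right add.right_neutral)
next
  case (Suc n)
  define c where "c = r (Suc n)"
  define g where "g = synthetic_div F c"
  have dg: "Polynomial.degree g = n" using Suc.hyps(2) by (simp add: g_def degree_synthetic_div)
  \<comment> \<open>Comparing top coefficients in the division identity: \<open>g\<close> inherits
    the leading coefficient of \<open>F\<close>, which keeps it outside \<open>J\<close> for the
    induction.\<close>
  have "Polynomial.coeff (F + Polynomial.smult c g) (Suc n) = Polynomial.coeff g n"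
    by (simp only: g_def synthetic_div_correct coeff_pCons_Suc)
  moreover have "Polynomial.coeff g (Suc n) = 0" using dg by (simp add: coeff_eq_0)
  ultimately have lc: "Polynomial.lead_coeff g = Polynomial.lead_coeff F"
    using dg by (simp flip: Suc.hyps(2))
  have eq: "poly F x - poly F c = (x - c) * poly g x" for x
  proof -
    have "poly F x = poly ([:- c, 1:] * g + [:poly F c:]) x"
      by (simp only: g_def synthetic_div_correct')
    then show ?thesis by (simp add: algebra_simps)
  qed
  show ?case
  proof (cases "\<exists>i\<le>n. r i - c \<in> J")
    case True
    then obtain i where "i \<le> n" "r i - c \<in> J" by blast
    then show ?thesis unfolding Suc.hyps(2)[symmetric]
      by (intro exI[of _ i] exI[of _ "Suc n"]) (auto simp: c_def)
  next
    case False
    have "poly g (r i) \<in> J" if "i \<le> n" for i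
    proof -
      have "poly F (r i) - poly F c \<in> J"
        using Suc.prems(2) Suc.hyps(2) that diff by (simp add: c_def)
      then show ?thesis using prime False that unfolding eq by blast
    qed
    then have "\<exists>i j. i < j \<and> j \<le> Polynomial.degree g \<and> r i - r j \<in> J"
      using Suc.hyps(1)[of g] dg lc Suc.prems(1) by simp
    then show ?thesis using dg Suc.hyps(2) by (metis le_SucI)
  qed
qed

section \<open>Isolated subgroups and the dependence bound given by the rank\<close>

text \<open>In an abelian group these are the subgroups with torsion-free quotient;
  \<open>isolated G {\<one>}\<close> says that \<open>G\<close> is torsion-free.\<close>

definition isolated :: "('a,'b) monoid_scheme \<Rightarrow> 'a set \<Rightarrow> bool" where
  "isolated A I \<longleftrightarrow> subgroup I A \<and>
     (\<forall>x\<in>carrier A. \<forall>n::nat. 0 < n \<and> x [^]\<^bsub>A\<^esub> n \<in> I \<longrightarrow> x \<in> I)"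

lemma isolated_subgroup: "isolated A I \<Longrightarrow> subgroup I A"
  by (simp add: isolated_def)

lemma isolatedD:
  "isolated A I \<Longrightarrow> x \<in> carrier A \<Longrightarrow> 0 < n \<Longrightarrow> x [^]\<^bsub>A\<^esub> (n::nat) \<in> I \<Longrightarrow> x \<in> I"
  by (auto simp only: isolated_def)

lemma (in group) isolated_int_pow:
  assumes "isolated G I" "x \<in> carrier G" "c \<noteq> 0" "x [^] (c::int) \<in> I"
  shows "x \<in> I"
proof -
  have I: "subgroup I G" using assms(1) by (rule isolated_subgroup)
  obtain n where n: "c = int n \<or> c = - int n" by (metis int_cases2)
  have "x [^] n \<in> I"
  proof (cases "c = int n")
    case True
    then show ?thesis using assms(4) by (simp only: int_pow_int)
  next
    case False
    then have "inv (x [^] n) \<in> I" using assms(2,4) n by (metis int_pow_neg_int)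
    then have "inv (inv (x [^] n)) \<in> I" by (rule subgroup.m_inv_closed[OF I])
    then show ?thesis using assms(2) by simp
  qed
  moreover have "0 < n" using n assms(3) by (cases n) auto
  ultimately show ?thesis by (intro isolatedD[OF assms(1,2)])
qed

context comm_group
begin

lemma finprod_in_subgroup:
  assumes "subgroup H G" "f \<in> A \<rightarrow> H"
  shows "finprod G f A \<in> H"
  using assms(2)
proof (induction A rule: infinite_finite_induct)
  case (insert x A)
  then have "f \<in> A \<rightarrow> carrier G" "f x \<in> carrier G"
    using subgroup.subset[OF assms(1)] by auto
  with insert show ?case using assms(1) by (auto simp: subgroup.m_closed)
qed (use assms(1) in \<open>auto simp: subgroup.one_closed\<close>)

text \<open>The exponents belong to indices rather than to elements because the family
  \<open>a\<close> may repeat values, as in the relation sought by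
  \<open>rank_dependent\<close>.\<close>

lemma generate_finprod:
  assumes "finite I" "a \<in> I \<rightarrow> carrier G" "h \<in> generate G (a ` I)"
  shows "\<exists>n::'i \<Rightarrow> int. h = (\<Otimes>i\<in>I. a i [^] n i)"
  using assms(3)
proof (induction rule: generate.induct)
  case one
  show ?case by (rule exI[of _ "\<lambda>_. 0"]) simp
next
  case (incl h)
  then obtain i where i: "i \<in> I" "h = a i" by auto
  have "(\<Otimes>j\<in>I. a j [^] (if i = j then 1 else (0::int))) = (\<Otimes>j\<in>I. if i = j then a j else \<one>)"
    using assms(2) by (intro finprod_cong') (auto simp: Pi_iff)
  then show ?case using i assms by (metis finprod_singleton)
next
  case (inv h)
  then obtain i where i: "i \<in> I" "h = a i" by auto
  have "(\<Otimes>j\<in>I. a j [^] (if i = j then -1 else (0::int))) = (\<Otimes>j\<in>I. if i = j then inv (a j) else \<one>)"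
    using assms(2) by (intro finprod_cong') (auto simp: Pi_iff int_pow_neg)
  also have "\<dots> = inv (a i)" using i assms by (intro finprod_singleton) auto
  finally show ?case using i by metis
next
  case (eng h1 h2)
  then obtain n m where "h1 = (\<Otimes>i\<in>I. a i [^] (n i::int))" "h2 = (\<Otimes>i\<in>I. a i [^] (m i::int))"
    by blast
  then have "h1 \<otimes> h2 = (\<Otimes>i\<in>I. a i [^] (n i::int) \<otimes> a i [^] (m i::int))"
    using assms(2) by (subst finprod_multf) (auto simp: Pi_iff)
  also have "\<dots> = (\<Otimes>i\<in>I. a i [^] (n i + m i))"
    using assms(2) by (intro finprod_cong') (auto simp: Pi_iff int_pow_mult)
  finally show ?case by (rule exI[of _ "\<lambda>i. n i + m i"])
qed

text \<open>Each exponent is split into its parity and twice its half. Thus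
  \<open>generate G T\<close> has at most \<open>2 ^ card T\<close> classes modulo squares,
  represented by subproducts of \<open>T\<close>.\<close>

lemma generate_mod_squares:
  assumes "finite T" "T \<subseteq> carrier G" "h \<in> generate G T"
  shows "\<exists>U\<subseteq>T. \<exists>k\<in>generate G T. h = (\<Otimes>t\<in>U. t) \<otimes> (k \<otimes> k)"
proof -
  have "(\<lambda>t. t) \<in> T \<rightarrow> carrier G" using assms by auto
  then obtain n where n: "h = (\<Otimes>t\<in>T. t [^] (n t::int))"
    using generate_finprod[of T "\<lambda>t. t" h] assms by auto
  define U where "U = {t\<in>T. odd (n t)}"
  define k where "k = (\<Otimes>t\<in>T. t [^] (n t div 2))"
  have gT: "subgroup (generate G T) G" using assms generate_is_subgroup by blast
  have kT: "k \<in> generate G T" unfolding k_def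
    by (rule finprod_in_subgroup[OF gT]) (auto intro: subgroup_int_pow_closed[OF gT] generate.incl)
  have c: "(\<lambda>t. t [^] (n t div 2)) \<in> T \<rightarrow> carrier G" using assms by auto
  have U: "(\<Otimes>t\<in>U. t) = (\<Otimes>t\<in>T. if odd (n t) then t else \<one>)"
    unfolding U_def using assms
    by (intro finprod_mono_neutral_cong_left) auto
  have "(\<Otimes>t\<in>U. t) \<otimes> (k \<otimes> k) =
      (\<Otimes>t\<in>T. (if odd (n t) then t else \<one>) \<otimes> (t [^] (n t div 2) \<otimes> t [^] (n t div 2)))"
    unfolding U k_def using assms c by (subst finprod_multf; (subst finprod_multf)?) auto
  also have "\<dots> = h" unfolding n
  proof (rule finprod_cong')
    fix t assume "t \<in> T"
    then have t: "t \<in> carrier G" using assms by auto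
    have "(if odd (n t) then t else \<one>) \<otimes> (t [^] (n t div 2) \<otimes> t [^] (n t div 2))
       = t [^] ((if odd (n t) then 1 else 0) + (n t div 2 + n t div 2))"
      using t by (simp only: int_pow_mult) auto
    also have "(if odd (n t) then 1 else 0) + (n t div 2 + n t div 2) = n t" by (auto elim: oddE)
    finally show "(if odd (n t) then t else \<one>) \<otimes> (t [^] (n t div 2) \<otimes> t [^] (n t div 2)) = t [^] n t" .
  qed (use assms in auto)
  finally have "h = (\<Otimes>t\<in>U. t) \<otimes> (k \<otimes> k)" ..
  moreover have "U \<subseteq> T" by (auto simp: U_def)
  ultimately show ?thesis using kT by auto
qed

text \<open>Pigeonhole replaces linear algebra: the \<open>2 ^ Suc r\<close> subproducts of the
  family fall into at most \<open>2 ^ r\<close> classes modulo squares of the subgroup they lie in.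
  Two subsets in one class give a relation.\<close>

lemma rank_dependent:
  assumes "fg_subgroups_generated_by G r" "a \<in> {..r} \<rightarrow> carrier G"
  shows "\<exists>c::nat \<Rightarrow> int. (\<exists>i\<le>r. c i \<noteq> 0) \<and> (\<Otimes>i\<in>{..r}. a i [^] c i) = \<one>"
proof -
  let ?S = "a ` {..r}"
  have S: "finite ?S" "?S \<subseteq> carrier G" using assms(2) by auto
  obtain T where T: "finite T" "T \<subseteq> carrier G" "card T \<le> r" "generate G T = generate G ?S"
    using assms(1) S unfolding fg_subgroups_generated_by_def by meson
  have gS: "subgroup (generate G ?S) G" using S generate_is_subgroup by blast
  define s where "s E = (\<Otimes>i\<in>E. a i)" for E
  have sg: "s E \<in> generate G ?S" if "E \<subseteq> {..r}" for E
    unfolding s_def using that by (intro finprod_in_subgroup[OF gS]) (auto intro: generate.incl)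
  have "\<forall>E\<in>Pow {..r}. \<exists>U\<in>Pow T. \<exists>k\<in>generate G T. s E = (\<Otimes>t\<in>U. t) \<otimes> (k \<otimes> k)"
    using generate_mod_squares[OF T(1,2)] sg T(4) by (metis Pow_iff)
  then obtain u where u: "\<And>E. E \<in> Pow {..r} \<Longrightarrow> u E \<in> Pow T"
    "\<And>E. E \<in> Pow {..r} \<Longrightarrow> \<exists>k\<in>generate G T. s E = (\<Otimes>t\<in>u E. t) \<otimes> (k \<otimes> k)"
    by metis
  have "(2::nat) ^ card T < 2 ^ Suc r" using T(3) by (intro power_strict_increasing) auto
  then have "card (Pow T) < card (Pow {..r})" using T(1) by (simp only: card_Pow finite_atMost card_atMost)
  moreover have "u ` Pow {..r} \<subseteq> Pow T" using u(1) by blast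
  ultimately have "\<not> inj_on u (Pow {..r})"
    using T(1) by (meson card_inj_on_le finite_Pow_iff leD)
  then obtain E E' where E: "E \<subseteq> {..r}" "E' \<subseteq> {..r}" "E \<noteq> E'" "u E = u E'"
    unfolding inj_on_def by auto
  obtain k k' where k: "k \<in> generate G T" "s E = (\<Otimes>t\<in>u E. t) \<otimes> (k \<otimes> k)"
    "k' \<in> generate G T" "s E' = (\<Otimes>t\<in>u E. t) \<otimes> (k' \<otimes> k')"
    using u(2)[of E] u(2)[of E'] E by auto
  have ac: "a i \<in> carrier G" if "i \<le> r" for i using assms(2) that by auto
  have gk: "k \<in> generate G ?S" "k' \<in> generate G ?S" using k T(4) by auto
  have ar: "a \<in> {..r} \<rightarrow> carrier G" by fact
  obtain n n' where n: "k = (\<Otimes>i\<in>{..r}. a i [^] (n i :: int))" "k' = (\<Otimes>i\<in>{..r}. a i [^] (n' i :: int))"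
    using generate_finprod[OF finite_atMost ar gk(1)] generate_finprod[OF finite_atMost ar gk(2)] by blast
  have sp: "s E \<otimes> (x \<otimes> x) = (\<Otimes>i\<in>{..r}. a i [^] ((if i \<in> E then 1 else 0) + 2 * m i))"
    if "E \<subseteq> {..r}" "x = (\<Otimes>i\<in>{..r}. a i [^] (m i :: int))" for E m x
  proof -
    have sE: "s E = (\<Otimes>i\<in>{..r}. if i \<in> E then a i else \<one>)"
      unfolding s_def using that ar by (intro finprod_mono_neutral_cong_left) auto
    have "s E \<otimes> (x \<otimes> x) = (\<Otimes>i\<in>{..r}. (if i \<in> E then a i else \<one>) \<otimes> (a i [^] m i \<otimes> a i [^] m i))"
      unfolding sE that(2) using ar by (subst finprod_multf; (subst finprod_multf)?) auto
    also have "\<dots> = (\<Otimes>i\<in>{..r}. a i [^] ((if i \<in> E then 1 else 0) + 2 * m i))"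
    proof (rule finprod_cong')
      fix i assume "i \<in> {..r}"
      then have i: "a i \<in> carrier G" using ac by auto
      then have "a i [^] ((if i \<in> E then 1 else 0) + (m i + m i)) =
         (if i \<in> E then a i else \<one>) \<otimes> (a i [^] m i \<otimes> a i [^] m i)"
        by (simp only: int_pow_mult) auto
      then show "(if i \<in> E then a i else \<one>) \<otimes> (a i [^] m i \<otimes> a i [^] m i)
         = a i [^] ((if i \<in> E then 1 else 0) + 2 * m i)" by (simp only: mult_2)
    qed (use ac in auto)
    finally show ?thesis .
  qed
  define x where "x = (\<Otimes>t\<in>u E. t)"
  have xc: "x \<in> carrier G" unfolding x_def using u(1)[of E] E(1) T(2)
    by (intro finprod_closed) auto
  have kc: "k \<in> carrier G" "k' \<in> carrier G" using k(1,3) T(2) generate_in_carrier by auto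
  have "s E \<otimes> (k' \<otimes> k') = s E' \<otimes> (k \<otimes> k)"
    unfolding k(2,4) x_def[symmetric] using xc kc by (simp add: m_ac)
  then have eq: "(\<Otimes>i\<in>{..r}. a i [^] ((if i \<in> E then 1 else 0) + 2 * n' i)) =
     (\<Otimes>i\<in>{..r}. a i [^] ((if i \<in> E' then 1 else 0) + 2 * n i))"
    using sp[OF E(1) n(2)] sp[OF E(2) n(1)] by simp
  \<comment> \<open>Modulo 2 the exponent \<open>c i\<close> is the difference of the indicators of
    \<open>E\<close> and \<open>E'\<close>, hence odd wherever the two subsets differ.\<close>
  define c where "c i = ((if i \<in> E then 1 else 0) + 2 * n' i) - ((if i \<in> E' then 1 else 0) + 2 * n i)" for i
  have "(\<Otimes>i\<in>{..r}. a i [^] c i) \<otimes> (\<Otimes>i\<in>{..r}. a i [^] ((if i \<in> E' then 1 else 0) + 2 * n i))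
      = (\<Otimes>i\<in>{..r}. a i [^] c i \<otimes> a i [^] ((if i \<in> E' then 1 else 0) + 2 * n i))"
    using ac by (subst finprod_multf) auto
  also have "\<dots> = (\<Otimes>i\<in>{..r}. a i [^] ((if i \<in> E then 1 else 0) + 2 * n' i))"
    using ac by (intro finprod_cong') (auto simp: int_pow_mult[symmetric] c_def)
  also note eq
  finally have "(\<Otimes>i\<in>{..r}. a i [^] c i) = \<one>"
    using ac by (subst (asm) r_cancel_one) (auto simp: Pi_iff intro!: finprod_closed)
  moreover obtain i where "i \<le> r" "i \<in> E \<longleftrightarrow> i \<notin> E'" using E by blast
  moreover have "c i \<noteq> 0"
  proof
    assume "c i = 0"
    then have "even (c i)" by simp
    then show False using \<open>i \<in> E \<longleftrightarrow> i \<notin> E'\<close> unfolding c_def by auto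
  qed
  ultimately show ?thesis by blast
qed

text \<open>Choose \<open>a i\<close> in each gap of the chain. In a relation among these
  \<open>r + 1\<close> elements the last nonzero exponent forces a power of \<open>a m\<close>,
  hence \<open>a m\<close> itself by isolation, into \<open>I m\<close>.\<close>

lemma no_long_isolated_chain:
  assumes "fg_subgroups_generated_by G r"
    and iso: "\<And>i. i \<le> Suc r \<Longrightarrow> isolated G (I i)"
    and strict: "\<And>i. i \<le> r \<Longrightarrow> I i \<subset> I (Suc i)"
  shows False
proof -
  have "\<forall>i\<in>{..r}. \<exists>x. x \<in> I (Suc i) - I i" using strict by fastforce
  then obtain a where a: "\<And>i. i \<le> r \<Longrightarrow> a i \<in> I (Suc i) - I i" by (metis atMost_iff)
  have sub: "subgroup (I i) G" if "i \<le> Suc r" for i using iso[OF that] by (rule isolated_subgroup)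
  have ac: "a i \<in> carrier G" if "i \<le> r" for i
    using a[OF that] sub[of "Suc i"] that subgroup.subset by auto
  obtain c :: "nat \<Rightarrow> int" where c: "\<exists>i\<le>r. c i \<noteq> 0" "(\<Otimes>i\<in>{..r}. a i [^] c i) = \<one>"
    using rank_dependent[OF assms(1), of a] ac by auto
  define m where "m = Max {i. i \<le> r \<and> c i \<noteq> 0}"
  have "m \<in> {i. i \<le> r \<and> c i \<noteq> 0}" unfolding m_def using c by (intro Max_in) auto
  then have m: "m \<le> r" "c m \<noteq> 0" by auto
  have max: "c i = 0" if "m < i" "i \<le> r" for i
    using that Max_ge[of "{i. i \<le> r \<and> c i \<noteq> 0}" i] unfolding m_def[symmetric] by force
  have mono: "I i \<subseteq> I j" if "i \<le> j" "j \<le> Suc r" for i j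
    using that
  proof (induction rule: dec_induct)
    case (step j)
    then show ?case using strict[of j] by auto
  qed simp
  have "(\<Otimes>i\<in>{..r}. a i [^] c i) = (\<Otimes>i\<in>{..m}. a i [^] c i)"
    using m ac max by (intro finprod_mono_neutral_cong_right) auto
  also have "\<dots> = a m [^] c m \<otimes> (\<Otimes>i\<in>{..<m}. a i [^] c i)"
    using m ac by (intro finprod_Suc3) auto
  finally have eq: "a m [^] c m \<otimes> (\<Otimes>i\<in>{..<m}. a i [^] c i) = \<one>" using c by simp
  have Im: "subgroup (I m) G" using sub m by auto
  have "a i \<in> I m" if "i < m" for i using mono[of "Suc i" m] a[of i] that m by auto
  then have p: "(\<Otimes>i\<in>{..<m}. a i [^] c i) \<in> I m"
    by (intro finprod_in_subgroup[OF Im]) (auto intro: subgroup_int_pow_closed[OF Im])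
  have "inv (\<Otimes>i\<in>{..<m}. a i [^] c i) = a m [^] c m"
    using eq ac m by (intro inv_equality) auto
  then have "a m [^] c m \<in> I m" using p Im by (metis subgroup.m_inv_closed)
  then have "a m \<in> I m" using isolated_int_pow[of "I m" "a m" "c m"] iso m ac by auto
  then show False using a m by auto
qed

lemma endo_kernel_isolated:
  assumes "isolated G {\<one>}" "isolated G V" "\<psi> \<in> hom G G"
  shows "isolated G {v\<in>V. \<psi> v = \<one>}"
proof -
  interpret h: group_hom G G \<psi> using assms(3) by unfold_locales
  have V: "subgroup V G" using assms(2) by (rule isolated_subgroup)
  have "subgroup {v\<in>V. \<psi> v = \<one>} G"
    using V by unfold_locales (auto simp: subgroup.m_closed subgroup.mem_carrier subgroup.m_inv_closed subgroup.one_closed)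
  moreover have "\<psi> x = \<one>" if "x \<in> carrier G" "0 < n" "\<psi> (x [^] n) = \<one>" for x and n :: nat
    using isolatedD[OF assms(1), of "\<psi> x" n] that h.hom_nat_pow[of x n] by auto
  ultimately show ?thesis using assms(2) unfolding isolated_def by blast
qed

lemma isolated_carrier: "isolated G (carrier G)"
  by (simp add: isolated_def subgroup_self)

text \<open>The exponents of a relation among the first \<open>r + 1\<close> iterates of
  \<open>a\<close> under \<open>\<phi>\<close> are the coefficients of the polynomial.\<close>

lemma exists_poly_killing:
  assumes "fg_subgroups_generated_by G r" "\<phi> \<in> hom G G" "a \<in> carrier G"
  shows "\<exists>p. p \<noteq> 0 \<and> poly_act G \<phi> p a = \<one>"
proof -
  have cl: "(\<phi> ^^ i) a \<in> carrier G" for i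
    using assms by (induction i) (auto simp: endo_closed)
  obtain c :: "nat \<Rightarrow> int" where c: "\<exists>i\<le>r. c i \<noteq> 0" "(\<Otimes>i\<in>{..r}. (\<phi> ^^ i) a [^] c i) = \<one>"
    using rank_dependent[OF assms(1), of "\<lambda>i. (\<phi> ^^ i) a"] cl by auto
  have hk: "\<phi> ^^ k \<in> hom G G" for k
    using assms(2) by (rule endo_funpow)
  have mon: "poly_act G \<phi> (Polynomial.monom d k) a = (\<phi> ^^ k) a [^] d" for d k
  proof -
    interpret h: group_hom G G "\<phi> ^^ k" using hk by unfold_locales
    show ?thesis using assms poly_act_monom h.hom_int_pow by simp
  qed
  define p where "p m = (\<Sum>i\<le>m. Polynomial.monom (c i) i)" for m
  have "poly_act G \<phi> (p m) a = (\<Otimes>i\<in>{..m}. (\<phi> ^^ i) a [^] c i)" for m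
  proof (induction m)
    case 0
    show ?case using assms by (simp add: p_def mon)
  next
    case (Suc m)
    have "p (Suc m) = Polynomial.monom (c (Suc m)) (Suc m) + p m" by (simp add: p_def add.commute)
    then show ?case using Suc assms cl by (simp add: poly_act_add mon Pi_iff)
  qed
  then have "poly_act G \<phi> (p r) a = \<one>" using c by simp
  moreover obtain i where "i \<le> r" "c i \<noteq> 0" using c by auto
  then have "Polynomial.coeff (p r) i \<noteq> 0"
    by (simp add: p_def coeff_sum)
  then have "p r \<noteq> 0" by auto
  ultimately show ?thesis by blast
qed

text \<open>The kernels of polynomials in \<open>\<phi>\<close> are isolated. If no \<open>f\<close>
  killed everything, multiplying \<open>f\<close> by a polynomial killing a missed element would
  enlarge its kernel forever, against the bound on chains.\<close>

lemma exists_annihilator: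
  assumes "fg_subgroups_generated_by G r" "\<phi> \<in> hom G G" "isolated G {\<one>}"
  shows "\<exists>f. f \<noteq> 0 \<and> (\<forall>a\<in>carrier G. poly_act G \<phi> f a = \<one>)"
proof (rule ccontr)
  assume none: "\<not> ?thesis"
  define K where "K f = {a\<in>carrier G. poly_act G \<phi> f a = \<one>}" for f
  have iso: "isolated G (K f)" for f
    unfolding K_def by (intro endo_kernel_isolated assms isolated_carrier poly_act_hom)
  have "\<exists>F. \<forall>n::nat. F n \<noteq> 0 \<and> K (F n) \<subset> K (F (Suc n))"
  proof (rule dependent_nat_choice)
    show "\<exists>f::int poly. f \<noteq> 0" by (rule exI[of _ 1]) simp
  next
    fix f :: "int poly" assume "f \<noteq> 0"
    then obtain a where a: "a \<in> carrier G" "poly_act G \<phi> f a \<noteq> \<one>" using none by blast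
    obtain p where p: "p \<noteq> 0" "poly_act G \<phi> p a = \<one>"
      using exists_poly_killing[OF assms(1,2) a(1)] by blast
    have "poly_act G \<phi> (p * f) b = \<one>" if "b \<in> K f" for b
      using that assms(2) by (simp add: poly_act_mult K_def endo_one[OF poly_act_hom])
    moreover have "poly_act G \<phi> (f * p) a = \<one>"
      using a p assms(2) by (simp add: poly_act_mult endo_one[OF poly_act_hom])
    ultimately have "K f \<subset> K (p * f)" using a by (auto simp: K_def mult.commute)
    then show "\<exists>g. g \<noteq> 0 \<and> K f \<subset> K g" using p \<open>f \<noteq> 0\<close> by (metis mult_eq_0_iff)
  qed
  then obtain F where "\<And>n::nat. K (F n) \<subset> K (F (Suc n))" by blast
  then show False using no_long_isolated_chain[OF assms(1), of "\<lambda>n. K (F n)"] iso by blast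
qed

section \<open>Minimal isolated subgroups and fixed points of commuting operators\<close>

text \<open>Descending chains obey the same bound, since reversing a finite piece of one gives an
  ascending chain.\<close>

lemma exists_minimal_isolated:
  assumes "fg_subgroups_generated_by G r" "P (carrier G)"
  shows "\<exists>V. isolated G V \<and> P V \<and> (\<forall>W. isolated G W \<and> P W \<longrightarrow> \<not> W \<subset> V)"
proof (rule ccontr)
  assume none: "\<not> ?thesis"
  have "\<exists>F. \<forall>n::nat. (isolated G (F n) \<and> P (F n)) \<and> F (Suc n) \<subset> F n"
  proof (rule dependent_nat_choice)
    show "\<exists>x. isolated G x \<and> P x" using isolated_carrier assms(2) by (intro exI conjI)
  next
    fix U assume "isolated G U \<and> P U"
    then obtain W where "isolated G W" "P W" "W \<subset> U" using none by auto
    then show "\<exists>Y. (isolated G Y \<and> P Y) \<and> Y \<subset> U" by auto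
  qed
  then obtain F where F: "\<forall>n::nat. (isolated G (F n) \<and> P (F n)) \<and> F (Suc n) \<subset> F n" ..
  show False
  proof (rule no_long_isolated_chain[OF assms(1), of "\<lambda>n. F (Suc r - n)"])
    fix i assume "i \<le> r"
    then show "F (Suc r - i) \<subset> F (Suc r - Suc i)"
      using F[rule_format, of "r - i"] by (simp add: Suc_diff_le)
  qed (use F in simp)
qed

text \<open>On a minimal nontrivial isolated \<open>\<Phi>\<close>-invariant \<open>V\<close> every
  polynomial in \<open>\<phi>\<close> is trivial or injective, so the annihilator of
  \<open>V\<close> is prime. Modulo it the powers of the variable are roots of \<open>f\<close>, so
  they repeat, and \<open>\<phi>\<close> has bounded finite order on \<open>V\<close>.\<close>

lemma exists_common_fixed_point:
  assumes rank: "fg_subgroups_generated_by G r" and tf: "isolated G {\<one>}"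
    and nontriv: "carrier G \<noteq> {\<one>}"
    and hom: "\<And>\<phi>. \<phi> \<in> \<Phi> \<Longrightarrow> \<phi> \<in> hom G G"
    and inj: "\<And>\<phi>. \<phi> \<in> \<Phi> \<Longrightarrow> inj_on \<phi> (carrier G)"
    and comm: "\<And>\<phi> \<psi> a. \<phi> \<in> \<Phi> \<Longrightarrow> \<psi> \<in> \<Phi> \<Longrightarrow> a \<in> carrier G \<Longrightarrow> \<phi> (\<psi> a) = \<psi> (\<phi> a)"
    and f: "f \<noteq> 0"
      "\<And>\<phi> k a. \<phi> \<in> \<Phi> \<Longrightarrow> a \<in> carrier G \<Longrightarrow> poly_act G (\<phi> ^^ k) f a = \<one>"
  shows "\<exists>N>0. \<exists>a\<in>carrier G. a \<noteq> \<one> \<and> (\<forall>\<phi>\<in>\<Phi>. (\<phi> ^^ N) a = a)"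
proof -
  obtain V where V: "isolated G V" "V \<noteq> {\<one>}" "\<And>\<phi>. \<phi> \<in> \<Phi> \<Longrightarrow> \<phi> ` V \<subseteq> V"
    and min: "\<And>W. isolated G W \<Longrightarrow> W \<noteq> {\<one>} \<Longrightarrow> (\<And>\<phi>. \<phi> \<in> \<Phi> \<Longrightarrow> \<phi> ` W \<subseteq> W) \<Longrightarrow> \<not> W \<subset> V"
    using exists_minimal_isolated[OF rank, of "\<lambda>V. V \<noteq> {\<one>} \<and> (\<forall>\<phi>\<in>\<Phi>. \<phi> ` V \<subseteq> V)"]
      nontriv hom endo_closed by (metis (no_types, lifting) image_subsetI)
  have Vs: "subgroup V G" using V(1) by (rule isolated_subgroup)
  have Vc: "v \<in> carrier G" if "v \<in> V" for v using that subgroup.subset[OF Vs] by auto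
  obtain v0 where v0: "v0 \<in> V" "v0 \<noteq> \<one>" using V(2) subgroup.one_closed[OF Vs] by blast
  have pV: "poly_act G \<phi> p v \<in> V" if "\<phi> \<in> \<Phi>" "v \<in> V" for \<phi> p v
  proof (induction p)
    case 0
    then show ?case using Vs by (simp add: subgroup.one_closed)
  next
    case (pCons c p)
    then show ?case using that V(3)[OF that(1)] hom Vc Vs
      by (auto simp: poly_act_pCons subgroup.m_closed subgroup_int_pow_closed)
  qed
  \<comment> \<open>The kernel of \<open>poly_act G \<phi> p\<close> in \<open>V\<close> is isolated
    and, since the operators commute, invariant under \<open>\<Phi>\<close>; by minimality one
    nontrivial element in it makes it all of \<open>V\<close>.\<close>
  have ker: "\<forall>v\<in>V. poly_act G \<phi> p v = \<one>"
    if "\<phi> \<in> \<Phi>" "w \<in> V" "w \<noteq> \<one>" "poly_act G \<phi> p w = \<one>" for \<phi> p w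
  proof -
    let ?W = "{v\<in>V. poly_act G \<phi> p v = \<one>}"
    have "isolated G ?W" by (intro endo_kernel_isolated tf V poly_act_hom hom that)
    moreover have "?W \<noteq> {\<one>}" using that by auto
    moreover have "\<psi> ` ?W \<subseteq> ?W" if "\<psi> \<in> \<Phi>" for \<psi>
    proof -
      have "poly_act G \<phi> p (\<psi> v) = \<psi> (poly_act G \<phi> p v)" if "v \<in> V" for v
        by (rule poly_act_commute[symmetric])
          (use that \<open>\<psi> \<in> \<Phi>\<close> \<open>\<phi> \<in> \<Phi>\<close> hom comm Vc in \<open>auto simp: comm_group_axioms\<close>)
      then show ?thesis using V(3)[OF that] endo_one[OF hom[OF that]] by auto
    qed
    ultimately show ?thesis using min[of ?W] by blast
  qed
  define n where "n = Polynomial.degree f"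
  have fixed: "\<exists>d>0. d \<le> n \<and> (\<forall>v\<in>V. (\<phi> ^^ d) v = v)" if \<phi>: "\<phi> \<in> \<Phi>" for \<phi>
  proof -
    note h = hom[OF \<phi>]
    have hk: "\<phi> ^^ k \<in> hom G G" for k
      using h by (rule endo_funpow)
    define J where "J = {p. \<forall>v\<in>V. poly_act G \<phi> p v = \<one>}"
    \<comment> \<open>The coefficients of \<open>f\<close> become constant polynomials, so that
      \<open>poly F q\<close> is the composition of \<open>f\<close> with \<open>q\<close> and
      powers of the variable can serve as roots.\<close>
    define F where "F = map_poly (\<lambda>x. [:x:]) f"
    have dF: "Polynomial.degree F = n" unfolding F_def n_def by (rule degree_map_poly) auto
    have lF: "Polynomial.lead_coeff F = [:Polynomial.lead_coeff f:]"
      using dF by (simp add: F_def n_def coeff_map_poly)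
    have "\<exists>i j. i < j \<and> j \<le> Polynomial.degree F \<and>
        Polynomial.monom 1 i - Polynomial.monom 1 j \<in> J"
    proof (rule exists_root_diff_in_prime)
      fix p q assume "p \<in> J" "q \<in> J"
      have "poly_act G \<phi> (p - q) v = \<one>" if "v \<in> V" for v
      proof -
        have "poly_act G \<phi> ((p - q) + q) v = poly_act G \<phi> (p - q) v \<otimes> poly_act G \<phi> q v"
          using Vc that h by (intro poly_act_add) auto
        then show ?thesis using \<open>p \<in> J\<close> \<open>q \<in> J\<close> that Vc h by (simp add: J_def poly_act_closed)
      qed
      then show "p - q \<in> J" by (simp add: J_def)
    next
      fix p q assume pq: "p * q \<in> J"
      show "p \<in> J \<or> q \<in> J"
      proof (cases "q \<in> J")
        case False
        then obtain w where w: "w \<in> V" "poly_act G \<phi> q w \<noteq> \<one>" by (auto simp: J_def)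
        have "poly_act G \<phi> p (poly_act G \<phi> q w) = \<one>"
          using pq w Vc h by (auto simp: J_def poly_act_mult)
        then have "\<forall>v\<in>V. poly_act G \<phi> p v = \<one>" by (rule ker[OF \<phi> pV[OF \<phi> w(1)] w(2)])
        then show ?thesis unfolding J_def by (intro disjI1 CollectI)
      qed simp
    next
      \<comment> \<open>A nonzero integer cannot annihilate \<open>V\<close>, because the group is
        torsion-free.\<close>
      have "v0 [^] Polynomial.lead_coeff f \<noteq> \<one>"
        using isolated_int_pow[OF tf Vc[OF v0(1)], of "Polynomial.lead_coeff f"] f(1) v0(2)
        by (metis leading_coeff_0_iff singletonD singletonI)
      then show "Polynomial.lead_coeff F \<notin> J"
        using v0(1) poly_act_const[OF h Vc[OF v0(1)]] lF unfolding J_def mem_Collect_eq by metis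
    next
      fix i assume "i \<le> Polynomial.degree F"
      have "poly_act G \<phi> (pcompose f (Polynomial.monom 1 i)) v = \<one>" if "v \<in> V" for v
      proof -
        have "poly_act G \<phi> (pcompose f (Polynomial.monom 1 i)) v
          = poly_act G (poly_act G \<phi> (Polynomial.monom 1 i)) f v"
          using h Vc that by (intro poly_act_pcompose) auto
        also have "\<dots> = poly_act G (\<phi> ^^ i) f v"
          using h hk Vc that by (intro poly_act_cong) (auto simp: poly_act_hom poly_act_monom)
        finally show ?thesis using f(2) \<phi> Vc that by auto
      qed
      then show "poly F (Polynomial.monom 1 i) \<in> J"
        by (simp add: F_def J_def pcompose_altdef)
    qed
    then obtain i j where ij: "i < j" "j \<le> n" "Polynomial.monom 1 i - Polynomial.monom 1 j \<in> J"
      using dF by auto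
    have "(\<phi> ^^ (j - i)) v = v" if "v \<in> V" for v
    proof -
      have "poly_act G \<phi> ((Polynomial.monom 1 i - Polynomial.monom 1 j) + Polynomial.monom 1 j) v
          = \<one> \<otimes> poly_act G \<phi> (Polynomial.monom 1 j) v"
        using Vc that h ij(3) by (subst poly_act_add) (auto simp: J_def)
      then have "(\<phi> ^^ i) v = (\<phi> ^^ j) v" using Vc that h endo_closed[OF hk]
        by (simp add: poly_act_monom)
      also have "\<dots> = (\<phi> ^^ i) ((\<phi> ^^ (j - i)) v)"
        using ij(1) by (metis comp_apply funpow_add le_add_diff_inverse less_imp_le)
      finally have "(\<phi> ^^ i) v = (\<phi> ^^ i) ((\<phi> ^^ (j - i)) v)" .
      moreover have "inj_on (\<phi> ^^ i) (carrier G)"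
      proof (induction i)
        case (Suc i)
        have "(\<phi> ^^ i) ` carrier G \<subseteq> carrier G" using endo_closed[OF hk] by auto
        then have "inj_on (\<phi> \<circ> (\<phi> ^^ i)) (carrier G)"
          by (intro comp_inj_on[OF Suc] inj_on_subset[OF inj[OF \<phi>]])
        then show ?case by (simp add: comp_def)
      qed simp
      ultimately show ?thesis using Vc[OF that] endo_closed[OF hk] by (metis inj_onD)
    qed
    then show ?thesis using ij by (intro exI[of _ "j - i"]) auto
  qed
  \<comment> \<open>The period \<open>d\<close> depends on \<open>\<phi>\<close> but is at most
    \<open>n\<close>, so \<open>fact n\<close> is a multiple of all periods and serves as the common
    \<open>N\<close>.\<close>
  have "(\<phi> ^^ fact n) v0 = v0" if \<phi>: "\<phi> \<in> \<Phi>" for \<phi>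
  proof -
    obtain d where d: "d > 0" "d \<le> n" "(\<phi> ^^ d) v0 = v0" using fixed[OF \<phi>] v0 by auto
    then have "d dvd fact n" by (simp add: dvd_fact Suc_le_eq)
    then obtain m where "fact n = d * m" by auto
    moreover have "(\<phi> ^^ (d * m)) v0 = v0"
      using d(3) by (induction m) (auto simp: funpow_add)
    ultimately show ?thesis by metis
  qed
  then show ?thesis using v0 Vc by (intro exI[of _ "fact n"]) auto
qed

end

section \<open>Bounded exponent and cosets\<close>

lemma (in group) fg_subgroups_generated_by_subgroup:
  assumes "subgroup H G" "fg_subgroups_generated_by G r"
  shows "fg_subgroups_generated_by (G\<lparr>carrier := H\<rparr>) r"
  unfolding fg_subgroups_generated_by_def
proof (intro allI impI)
  fix S assume S: "finite S \<and> S \<subseteq> carrier (G\<lparr>carrier := H\<rparr>)"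
  then have SH: "S \<subseteq> H" "S \<subseteq> carrier G" using subgroup.subset[OF assms(1)] by auto
  then obtain T where T: "finite T" "T \<subseteq> carrier G" "card T \<le> r" "generate G T = generate G S"
    using assms(2) S unfolding fg_subgroups_generated_by_def by meson
  have "T \<subseteq> generate G T" by (auto intro: generate.incl)
  also have "\<dots> \<subseteq> H" using T(4) generate_subgroup_incl[OF SH(1) assms(1)] by simp
  finally have "T \<subseteq> H" .
  with T SH show "\<exists>T. finite T \<and> T \<subseteq> carrier (G\<lparr>carrier := H\<rparr>) \<and> card T \<le> r \<and>
    generate (G\<lparr>carrier := H\<rparr>) T = generate (G\<lparr>carrier := H\<rparr>) S"
    using generate_consistent[OF _ assms(1)] by auto
qed

lemma (in group_hom) fg_subgroups_generated_by_image:
  assumes "h ` carrier G = carrier H" "fg_subgroups_generated_by G r"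
  shows "fg_subgroups_generated_by H r"
  unfolding fg_subgroups_generated_by_def
proof (intro allI impI)
  fix S assume S: "finite S \<and> S \<subseteq> carrier H"
  then obtain S' where S': "S' \<subseteq> carrier G" "finite S'" "S = h ` S'"
    using assms(1) finite_subset_image by metis
  then obtain T where T: "finite T" "T \<subseteq> carrier G" "card T \<le> r" "generate G T = generate G S'"
    using assms(2) unfolding fg_subgroups_generated_by_def by meson
  have "generate H (h ` T) = generate H S" using T S' by (simp add: generate_img)
  moreover have "card (h ` T) \<le> r" using T card_image_le order_trans by blast
  ultimately show "\<exists>T. finite T \<and> T \<subseteq> carrier H \<and> card T \<le> r \<and> generate H T = generate H S"
    using T by (intro exI[of _ "h ` T"]) auto
qed

lemma (in normal) group_hom_Mod: "group_hom G (G Mod H) (\<lambda>a. H #> a)"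
  by (simp add: group_hom_def group_hom_axioms_def r_coset_hom_Mod factorgroup_is_group is_group)

lemma (in normal) fg_subgroups_generated_by_Mod:
  assumes "fg_subgroups_generated_by G r"
  shows "fg_subgroups_generated_by (G Mod H) r"
  by (rule group_hom.fg_subgroups_generated_by_image[OF group_hom_Mod _ assms])
    (simp add: carrier_FactGroup)

lemma (in group) nat_pow_mod:
  assumes "t \<in> carrier G" "t [^] (n::nat) = \<one>" "0 < n"
  shows "t [^] (m::int) = t [^] nat (m mod int n)"
proof -
  have "t [^] m = t [^] (int n * (m div int n) + m mod int n)" by simp
  also have "\<dots> = (t [^] int n) [^] (m div int n) \<otimes> t [^] (m mod int n)"
    using assms(1) by (simp only: int_pow_mult int_pow_pow)
  also have "t [^] int n = \<one>" using assms(2) by (simp add: int_pow_int)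
  finally show ?thesis using assms(1,3) by (simp add: pow_nat)
qed

context comm_group
begin

lemma card_generate_le:
  assumes "finite T" "T \<subseteq> carrier G" "\<And>x. x \<in> carrier G \<Longrightarrow> x [^] (n::nat) = \<one>" "0 < n"
  shows "finite (generate G T)" "card (generate G T) \<le> n ^ card T"
proof -
  let ?E = "T \<rightarrow>\<^sub>E {..<n}"
  have "generate G T \<subseteq> (\<lambda>e. \<Otimes>t\<in>T. t [^] e t) ` ?E"
  proof
    fix h assume h: "h \<in> generate G T"
    obtain m where m: "h = (\<Otimes>t\<in>T. t [^] (m t :: int))"
      using generate_finprod[OF assms(1), of "\<lambda>t. t" h] h assms(2) by auto
    define e where "e = (\<lambda>t\<in>T. nat (m t mod int n))"
    have "h = (\<Otimes>t\<in>T. t [^] e t)"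
      unfolding m
    proof (rule finprod_cong')
      fix t assume t: "t \<in> T"
      then have tc: "t \<in> carrier G" using assms(2) by auto
      show "t [^] m t = t [^] e t" using nat_pow_mod[OF tc assms(3)[OF tc] assms(4), of "m t"] t
        by (simp add: e_def)
    qed (use assms(2) in auto)
    moreover have "e \<in> ?E" using assms(4) by (auto simp: e_def nat_less_iff)
    ultimately show "h \<in> (\<lambda>e. \<Otimes>t\<in>T. t [^] e t) ` ?E" by blast
  qed
  moreover have "finite ?E" using assms(1) by (simp add: finite_PiE)
  ultimately have "finite (generate G T) \<and> card (generate G T) \<le> card ?E"
    by (meson card_image_le card_mono finite_imageI finite_subset le_trans)
  then show "finite (generate G T)" "card (generate G T) \<le> n ^ card T"
    using assms(1) by (auto simp: card_PiE)
qed

text \<open>Otherwise more than \<open>n ^ r\<close> elements could be chosen, but the subgroup they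
  generate needs at most \<open>r\<close> generators and so has at most \<open>n ^ r\<close>
  elements.\<close>

lemma finite_if_bounded_exponent:
  assumes "fg_subgroups_generated_by G r" "\<And>x. x \<in> carrier G \<Longrightarrow> x [^] (n::nat) = \<one>" "0 < n"
  shows "finite (carrier G)"
proof (rule ccontr)
  assume "infinite (carrier G)"
  then obtain S where S: "finite S" "card S = Suc (n ^ r)" "S \<subseteq> carrier G"
    using infinite_arbitrarily_large by blast
  then obtain T where T: "finite T" "T \<subseteq> carrier G" "card T \<le> r" "generate G T = generate G S"
    using assms(1) unfolding fg_subgroups_generated_by_def by meson
  note g = card_generate_le[OF T(1,2) assms(2,3)]
  have "S \<subseteq> generate G T" using T(4) by (auto intro: generate.incl)
  then have "card S \<le> card (generate G T)" using g(1) by (rule card_mono[rotated])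
  also have "\<dots> \<le> n ^ card T" by (rule g(2))
  also have "\<dots> \<le> n ^ r" using T(3) assms(3) by (intro power_increasing) auto
  finally show False using S by simp
qed

end

text \<open>Induction on the derived length: the derived subgroup is finite by induction, the
  abelian quotient by the rank bound, so \<open>H\<close> is covered by finitely many finite
  cosets.\<close>

lemma (in group) finite_subgroup_bounded_exponent:
  assumes "fg_subgroups_generated_by G r" "0 < n"
    and "subgroup H G" "(derived G ^^ k) H = {\<one>}" "\<And>x. x \<in> H \<Longrightarrow> x [^] (n::nat) = \<one>"
  shows "finite H"
  using assms(3-5)
proof (induction k arbitrary: H)
  case 0
  then show ?case by simp
next
  case (Suc k)
  let ?D = "derived G H" and ?H = "G\<lparr>carrier := H\<rparr>"
  have HG: "H \<subseteq> carrier G" using Suc.prems(1) by (rule subgroup.subset)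
  have D: "subgroup ?D G" using derived_is_subgroup[OF HG] .
  have DH: "?D \<subseteq> H" using derived_incl[OF _ Suc.prems(1)] by auto
  have "(derived G ^^ k) ?D = {\<one>}" using Suc.prems(2) by (simp add: funpow_swap1)
  then have fD: "finite ?D" using Suc.IH[OF D] Suc.prems(3) DH by blast
  have n: "?D \<lhd> ?H" using derived_subgroup_is_normal[OF Suc.prems(1)] .
  interpret N: normal ?D ?H by (rule n)
  interpret Q: comm_group "?H Mod ?D"
    using derived_quot_of_subgroup_is_comm_group[OF Suc.prems(1)] .
  have "fg_subgroups_generated_by (?H Mod ?D) r"
    using N.fg_subgroups_generated_by_Mod fg_subgroups_generated_by_subgroup assms(1) Suc.prems(1) by blast
  moreover have "x [^]\<^bsub>?H Mod ?D\<^esub> n = \<one>\<^bsub>?H Mod ?D\<^esub>" if x: "x \<in> carrier (?H Mod ?D)" for x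
  proof -
    obtain y where y: "y \<in> H" "x = ?D #>\<^bsub>?H\<^esub> y" using x by (auto simp: carrier_FactGroup)
    have "x [^]\<^bsub>?H Mod ?D\<^esub> n = ?D #>\<^bsub>?H\<^esub> (y [^]\<^bsub>?H\<^esub> n)"
      using y N.FactGroup_pow[of y n] by simp
    also have "y [^]\<^bsub>?H\<^esub> n = \<one>" using Suc.prems(3)[OF y(1)] nat_pow_consistent by metis
    finally show ?thesis using subgroup.subset[OF D] by simp
  qed
  ultimately have "finite (carrier (?H Mod ?D))"
    using assms(2) by (rule Q.finite_if_bounded_exponent)
  moreover have "finite c" if "c \<in> carrier (?H Mod ?D)" for c
    using that fD by (auto simp: carrier_FactGroup r_coset_def)
  moreover have "H \<subseteq> \<Union>(carrier (?H Mod ?D))"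
  proof
    fix x assume "x \<in> H"
    then show "x \<in> \<Union>(carrier (?H Mod ?D))"
      using rcos_self[OF _ D, of x] HG by (auto simp: carrier_FactGroup)
  qed
  ultimately show ?case by (meson finite_Union finite_subset)
qed

section \<open>Finite index, expressed through the image of a set under the coset map\<close>

context group
begin

lemma rcos_eq_iff:
  assumes "subgroup H G" "x \<in> carrier G" "y \<in> carrier G"
  shows "H #> x = H #> y \<longleftrightarrow> x \<otimes> inv y \<in> H"
proof
  assume "H #> x = H #> y"
  then have "x \<in> H #> y" using rcos_self assms by metis
  then show "x \<otimes> inv y \<in> H" using subgroup.rcos_module_imp[OF assms(1)] assms by auto
next
  assume "x \<otimes> inv y \<in> H"
  then have "x \<in> H #> y" using subgroup.rcos_module_rev[OF assms(1)] assms by auto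
  then show "H #> x = H #> y" using repr_independence assms by metis
qed

text \<open>Any invariant \<open>f\<close> fine enough to determine the coset of \<open>H\<close>
  bounds the number of cosets; a representative is chosen in each fibre.\<close>

lemma finite_cosets_if_finite_image:
  assumes "subgroup H G" "K \<subseteq> carrier G" "finite (f ` K)"
    and "\<And>x y. x \<in> K \<Longrightarrow> y \<in> K \<Longrightarrow> f x = f y \<Longrightarrow> x \<otimes> inv y \<in> H"
  shows "finite ((\<lambda>x. H #> x) ` K)"
proof (rule finite_subset)
  show "finite ((\<lambda>v. H #> (SOME x. x \<in> K \<and> f x = v)) ` (f ` K))" using assms(3) by simp
  show "(\<lambda>x. H #> x) ` K \<subseteq> (\<lambda>v. H #> (SOME x. x \<in> K \<and> f x = v)) ` (f ` K)"
  proof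
    fix c assume "c \<in> (\<lambda>x. H #> x) ` K"
    then obtain x where x: "x \<in> K" "c = H #> x" by auto
    define y where "y = (SOME y. y \<in> K \<and> f y = f x)"
    have y: "y \<in> K \<and> f y = f x" unfolding y_def by (rule someI[of _ x]) (use x in simp)
    then have "H #> x = H #> y" using assms x by (subst rcos_eq_iff) auto
    then show "c \<in> (\<lambda>v. H #> (SOME x. x \<in> K \<and> f x = v)) ` (f ` K)"
      using x y_def by auto
  qed
qed

text \<open>Transitivity of finite index: a coset of an element of \<open>N\<close> is some
  \<open>H #> k\<close> with \<open>k\<close> in \<open>K\<close>, translated by one of the finitely
  many representatives \<open>Y\<close>.\<close>

lemma finite_cosets_trans:
  assumes "subgroup H G" "subgroup K G" "N \<subseteq> carrier G"
    and "finite ((\<lambda>x. H #> x) ` K)" "finite ((\<lambda>x. K #> x) ` N)"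
  shows "finite ((\<lambda>x. H #> x) ` N)"
proof -
  obtain Y where Y: "Y \<subseteq> N" "finite Y" "(\<lambda>x. K #> x) ` N = (\<lambda>x. K #> x) ` Y"
    using finite_subset_image[OF assms(5) subset_refl] by auto
  have "(\<lambda>x. H #> x) ` N \<subseteq> (\<lambda>(c, y). c #> y) ` ((\<lambda>x. H #> x) ` K \<times> Y)"
  proof
    fix c assume "c \<in> (\<lambda>x. H #> x) ` N"
    then obtain x where x: "x \<in> N" "c = H #> x" by auto
    then have "K #> x \<in> (\<lambda>x. K #> x) ` Y" using Y(3) by auto
    then obtain y where y: "y \<in> Y" "K #> x = K #> y" by auto
    have xy: "x \<in> carrier G" "y \<in> carrier G" using x y Y assms(3) by auto
    then have k: "x \<otimes> inv y \<in> K" using y(2) rcos_eq_iff assms(2) by simp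
    have "H #> (x \<otimes> inv y) #> y = H #> x"
      using xy subgroup.subset[OF assms(1)] by (simp add: coset_mult_assoc m_assoc)
    then have "c = (H #> (x \<otimes> inv y)) #> y" using x by simp
    then show "c \<in> (\<lambda>(c, y). c #> y) ` ((\<lambda>x. H #> x) ` K \<times> Y)" using k y by force
  qed
  then show ?thesis using assms(4) Y(2) by (meson finite_SigmaI finite_imageI finite_subset)
qed

lemma finite_cosets_Int:
  assumes "subgroup H G" "subgroup K G" "N \<subseteq> carrier G"
    and "finite ((\<lambda>x. H #> x) ` N)" "finite ((\<lambda>x. K #> x) ` N)"
  shows "finite ((\<lambda>x. (H \<inter> K) #> x) ` N)"
proof (rule finite_cosets_if_finite_image)
  show "subgroup (H \<inter> K) G" using assms subgroups_Inter_pair by blast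
  have "(\<lambda>x. (H #> x, K #> x)) ` N \<subseteq> (\<lambda>x. H #> x) ` N \<times> (\<lambda>x. K #> x) ` N" by auto
  then show "finite ((\<lambda>x. (H #> x, K #> x)) ` N)"
    using assms by (meson finite_SigmaI finite_subset)
next
  fix x y assume "x \<in> N" "y \<in> N" "(H #> x, K #> x) = (H #> y, K #> y)"
  then show "x \<otimes> inv y \<in> H \<inter> K" using rcos_eq_iff assms by auto
qed (use assms in auto)

text \<open>The image of \<open>U\<close> in \<open>G Mod V\<close> is soluble, of bounded rank and
  of exponent dividing \<open>n\<close>, hence finite.\<close>

lemma finite_cosets_bounded_exponent:
  assumes "solvable G" "fg_subgroups_generated_by G r" "0 < n"
    and "V \<lhd> G" "subgroup U G" "\<And>x. x \<in> U \<Longrightarrow> x [^] (n::nat) \<in> V"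
  shows "finite ((\<lambda>x. V #> x) ` U)"
proof -
  interpret V: normal V G by fact
  interpret h: group_hom G "G Mod V" "\<lambda>a. V #> a" by (rule V.group_hom_Mod)
  obtain k where k: "(derived G ^^ k) (carrier G) = {\<one>}"
    using assms(1) solvable_iff_trivial_derived_seq by auto
  have UG: "U \<subseteq> carrier G" using assms(5) by (rule subgroup.subset)
  have "(derived G ^^ k) U \<subseteq> {\<one>}" using mono_exp_of_derived[OF UG, of k] k by simp
  then have dU: "(derived G ^^ k) U = {\<one>}"
    using subgroup.one_closed[OF exp_of_derived_is_subgroup[OF assms(5), of k]] by auto
  have U': "subgroup ((\<lambda>x. V #> x) ` U) (G Mod V)"
    using h.subgroup_img_is_subgroup[OF assms(5)] by simp
  have d: "(derived (G Mod V) ^^ k) ((\<lambda>x. V #> x) ` U) = {\<one>\<^bsub>G Mod V\<^esub>}"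
    using h.exp_of_derived_img[OF UG, of k] dU V.subset by simp
  show ?thesis
  proof (rule h.H.finite_subgroup_bounded_exponent[OF _ assms(3) U' d])
    show "fg_subgroups_generated_by (G Mod V) r" by (rule V.fg_subgroups_generated_by_Mod) fact
  next
    fix x assume "x \<in> (\<lambda>x. V #> x) ` U"
    then obtain u where u: "u \<in> U" "x = V #> u" by auto
    then have "x [^]\<^bsub>G Mod V\<^esub> n = V #> (u [^] n)" using V.FactGroup_pow[of u n] UG by auto
    then show "x [^]\<^bsub>G Mod V\<^esub> n = \<one>\<^bsub>G Mod V\<^esub>"
      using assms(6)[OF u(1)] V.rcos_const[OF is_group] by simp
  qed
qed

end

section \<open>Characteristic subgroups\<close>

text \<open>Asking for inclusion amounts to equality: the inverse automorphism supplies the other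
  inclusion, as \<open>characteristic_preimage\<close> records.\<close>

definition characteristic :: "('a,'b) monoid_scheme \<Rightarrow> 'a set \<Rightarrow> bool" where
  "characteristic G H \<longleftrightarrow> subgroup H G \<and> (\<forall>\<gamma>\<in>auto G. \<gamma> ` H \<subseteq> H)"

text \<open>For normal \<open>V\<close> these elements centralize the image of \<open>U\<close> in
  \<open>G / V\<close>. The commutator form also makes sense for \<open>V\<close> outside
  \<open>U\<close>, as with \<open>res\<close> and \<open>C\<close> later.\<close>

definition section_centralizer :: "('a,'b) monoid_scheme \<Rightarrow> 'a set \<Rightarrow> 'a set \<Rightarrow> 'a set" where
  "section_centralizer G U V =
     {x\<in>carrier G. \<forall>u\<in>U. x \<otimes>\<^bsub>G\<^esub> u \<otimes>\<^bsub>G\<^esub> inv\<^bsub>G\<^esub> x \<otimes>\<^bsub>G\<^esub> inv\<^bsub>G\<^esub> u \<in> V}"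

context group
begin

lemma group_cancel:
  "g \<in> carrier G \<Longrightarrow> a \<in> carrier G \<Longrightarrow> inv g \<otimes> (g \<otimes> a) = a"
  "g \<in> carrier G \<Longrightarrow> a \<in> carrier G \<Longrightarrow> g \<otimes> (inv g \<otimes> a) = a"
  by (simp_all flip: m_assoc)

lemma auto_group_hom: "\<gamma> \<in> auto G \<Longrightarrow> group_hom G G \<gamma>"
  by (simp add: auto_def group_hom_def group_hom_axioms_def)

lemma auto_closed: "\<gamma> \<in> auto G \<Longrightarrow> x \<in> carrier G \<Longrightarrow> \<gamma> x \<in> carrier G"
  by (rule group_hom.hom_closed[OF auto_group_hom])

lemma auto_inverse:
  assumes "\<gamma> \<in> auto G"
  shows "\<exists>\<delta>\<in>auto G. \<forall>x\<in>carrier G. \<delta> (\<gamma> x) = x \<and> \<gamma> (\<delta> x) = x"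
proof
  \<comment> \<open>Elements of \<open>auto G\<close> are extensional functions, so the inverse has
    to be restricted to the carrier.\<close>
  let ?d = "restrict (inv_into (carrier G) \<gamma>) (carrier G)"
  have g: "\<gamma> \<in> hom G G" "\<gamma> \<in> Bij (carrier G)" using assms by (auto simp: auto_def)
  then show "?d \<in> auto G"
    using restrict_inv_into_hom restrict_inv_into_Bij by (simp add: auto_def)
  have b: "bij_betw \<gamma> (carrier G) (carrier G)" using g(2) by (simp add: Bij_def)
  show "\<forall>x\<in>carrier G. ?d (\<gamma> x) = x \<and> \<gamma> (?d x) = x"
  proof
    fix x assume x: "x \<in> carrier G"
    then have "inv_into (carrier G) \<gamma> (\<gamma> x) = x" using b by (simp add: bij_betw_def)
    moreover have "\<gamma> (inv_into (carrier G) \<gamma> x) = x" using b x by (simp add: bij_betw_def f_inv_into_f)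
    ultimately show "?d (\<gamma> x) = x \<and> \<gamma> (?d x) = x" using x auto_closed[OF assms x] by simp
  qed
qed

lemma inner_auto:
  assumes "g \<in> carrier G"
  shows "(\<lambda>x\<in>carrier G. g \<otimes> x \<otimes> inv g) \<in> auto G"
proof -
  have h: "(\<lambda>x\<in>carrier G. g \<otimes> x \<otimes> inv g) \<in> hom G G"
    using assms by (auto simp: hom_def m_assoc group_cancel)
  have "bij_betw (\<lambda>x\<in>carrier G. g \<otimes> x \<otimes> inv g) (carrier G) (carrier G)"
    by (rule bij_betw_byWitness[where f' = "\<lambda>x. inv g \<otimes> x \<otimes> g"])
      (use assms in \<open>auto simp: m_assoc group_cancel\<close>)
  then show ?thesis using h by (simp add: auto_def Bij_def)
qed

lemma characteristic_subgroup: "characteristic G H \<Longrightarrow> subgroup H G"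
  by (simp add: characteristic_def)

lemma characteristicD: "characteristic G H \<Longrightarrow> \<gamma> \<in> auto G \<Longrightarrow> x \<in> H \<Longrightarrow> \<gamma> x \<in> H"
  by (auto simp: characteristic_def)

lemma characteristicI:
  "subgroup H G \<Longrightarrow> (\<And>\<gamma> x. \<gamma> \<in> auto G \<Longrightarrow> x \<in> H \<Longrightarrow> \<gamma> x \<in> H) \<Longrightarrow> characteristic G H"
  by (auto simp: characteristic_def)

lemma characteristic_preimage:
  assumes "characteristic G H" "\<gamma> \<in> auto G" "x \<in> H"
  shows "\<exists>y\<in>H. \<gamma> y = x"
proof -
  obtain \<delta> where d: "\<delta> \<in> auto G" "\<forall>x\<in>carrier G. \<delta> (\<gamma> x) = x \<and> \<gamma> (\<delta> x) = x"
    using auto_inverse assms(2) by blast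
  have "x \<in> carrier G" using assms characteristic_subgroup subgroup.mem_carrier by fast
  then show ?thesis using d characteristicD[OF assms(1) d(1) assms(3)] by auto
qed

lemma characteristic_normal:
  assumes "characteristic G H"
  shows "H \<lhd> G"
proof (rule normal_invI)
  show H: "subgroup H G" using assms by (rule characteristic_subgroup)
  fix x h assume "x \<in> carrier G" "h \<in> H"
  then show "x \<otimes> h \<otimes> inv x \<in> H"
    using characteristicD[OF assms inner_auto[of x], of h] subgroup.mem_carrier[OF H, of h] by simp
qed

lemma characteristic_carrier: "characteristic G (carrier G)"
  unfolding characteristic_def using subgroup_self auto_closed by blast

lemma characteristic_one: "characteristic G {\<one>}"
  by (rule characteristicI[OF triv_subgroup])
    (use group_hom.hom_one[OF auto_group_hom] in auto)

lemma characteristic_Int: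
  "characteristic G H \<Longrightarrow> characteristic G K \<Longrightarrow> characteristic G (H \<inter> K)"
  by (auto simp: characteristic_def subgroups_Inter_pair image_subset_iff)

lemma characteristic_generate:
  assumes "S \<subseteq> carrier G" "\<And>\<gamma> x. \<gamma> \<in> auto G \<Longrightarrow> x \<in> S \<Longrightarrow> \<gamma> x \<in> generate G S"
  shows "characteristic G (generate G S)"
proof (rule characteristicI)
  show gS: "subgroup (generate G S) G" using assms(1) by (rule generate_is_subgroup)
  fix \<gamma> x assume g: "\<gamma> \<in> auto G" and x: "x \<in> generate G S"
  interpret h: group_hom G G \<gamma> using g by (rule auto_group_hom)
  have "\<gamma> x \<in> generate G (\<gamma> ` S)" using x h.generate_img[OF assms(1)] by auto
  then show "\<gamma> x \<in> generate G S"
    using generate_subgroup_incl[OF _ gS, of "\<gamma> ` S"] assms(2)[OF g] by auto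
qed

lemma auto_commutator:
  assumes "\<gamma> \<in> auto G" "x \<in> carrier G" "y \<in> carrier G"
  shows "\<gamma> (x \<otimes> y \<otimes> inv x \<otimes> inv y) = \<gamma> x \<otimes> \<gamma> y \<otimes> inv (\<gamma> x) \<otimes> inv (\<gamma> y)"
proof -
  interpret h: group_hom G G \<gamma> using assms(1) by (rule auto_group_hom)
  show ?thesis using assms by simp
qed

lemma characteristic_commutator_subgroup:
  assumes "characteristic G H" "characteristic G K"
  shows "characteristic G (commutator_subgroup G H K)"
  unfolding commutator_subgroup_def
proof (rule characteristic_generate)
  have c: "H \<subseteq> carrier G" "K \<subseteq> carrier G"
    using assms characteristic_subgroup subgroup.subset by blast+
  then show "(\<Union>a\<in>H. \<Union>b\<in>K. {a \<otimes> b \<otimes> inv a \<otimes> inv b}) \<subseteq> carrier G"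
    by (auto simp: subset_iff)
  fix \<gamma> x assume g: "\<gamma> \<in> auto G" and "x \<in> (\<Union>a\<in>H. \<Union>b\<in>K. {a \<otimes> b \<otimes> inv a \<otimes> inv b})"
  then obtain a b where ab: "a \<in> H" "b \<in> K" "x = a \<otimes> b \<otimes> inv a \<otimes> inv b" by auto
  have "\<gamma> x = \<gamma> a \<otimes> \<gamma> b \<otimes> inv (\<gamma> a) \<otimes> inv (\<gamma> b)"
    unfolding ab(3) using auto_commutator[OF g] ab c by auto
  then show "\<gamma> x \<in> generate G (\<Union>a\<in>H. \<Union>b\<in>K. {a \<otimes> b \<otimes> inv a \<otimes> inv b})"
    using characteristicD[OF assms(1) g ab(1)] characteristicD[OF assms(2) g ab(2)]
    by (intro generate.incl) auto
qed

lemma derived_eq_commutator_subgroup: "derived G H = commutator_subgroup G H H"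
  by (simp add: derived_def commutator_subgroup_def)

lemma characteristic_derived: "characteristic G H \<Longrightarrow> characteristic G (derived G H)"
  by (simp add: derived_eq_commutator_subgroup characteristic_commutator_subgroup)

lemma commutator_mem_normal:
  assumes "N \<lhd> G" "x \<in> carrier G" "y \<in> N"
  shows "y \<otimes> x \<otimes> inv y \<otimes> inv x \<in> N"
proof -
  interpret N: normal N G by fact
  have y: "y \<in> carrier G" using assms by auto
  have "y \<otimes> (x \<otimes> inv y \<otimes> inv x) \<in> N" using assms N.inv_op_closed2 by auto
  then show ?thesis using assms y by (simp add: m_assoc)
qed

lemma inv_commutator:
  assumes "x \<in> carrier G" "y \<in> carrier G"
  shows "inv (x \<otimes> y \<otimes> inv x \<otimes> inv y) = y \<otimes> x \<otimes> inv y \<otimes> inv x"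
  using assms by (simp add: inv_mult_group m_assoc)

lemma subgroup_section_centralizer:
  assumes "U \<lhd> G" "V \<lhd> G"
  shows "subgroup (section_centralizer G U V) G"
proof -
  interpret U: normal U G by fact
  interpret V: normal V G by fact
  show ?thesis
  proof (rule subgroupI)
    show "section_centralizer G U V \<subseteq> carrier G" by (auto simp: section_centralizer_def)
    have "\<one> \<in> section_centralizer G U V" by (auto simp: section_centralizer_def)
    then show "section_centralizer G U V \<noteq> {}" by auto
  next
    fix x assume "x \<in> section_centralizer G U V"
    then have x: "x \<in> carrier G" "\<And>u. u \<in> U \<Longrightarrow> x \<otimes> u \<otimes> inv x \<otimes> inv u \<in> V"
      by (auto simp: section_centralizer_def)
    have "inv x \<otimes> u \<otimes> inv (inv x) \<otimes> inv u \<in> V" if u: "u \<in> U" for u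
    proof -
      \<comment> \<open>With \<open>[a, b]\<close> for \<open>a b a^-1 b^-1\<close>, the commutator
        \<open>[x^-1, u]\<close> is the inverse of \<open>[x, ?u]\<close>.\<close>
      let ?u = "inv x \<otimes> u \<otimes> x"
      have uc: "u \<in> carrier G" using u by auto
      have "inv (x \<otimes> ?u \<otimes> inv x \<otimes> inv ?u) \<in> V"
        using x(2)[OF U.inv_op_closed1[OF x(1) u]] by (rule V.m_inv_closed)
      moreover have "x \<otimes> ?u \<otimes> inv x = u" using x uc by (simp add: m_assoc group_cancel)
      ultimately show ?thesis using x(1) uc by (simp add: inv_mult_group m_assoc)
    qed
    then show "inv x \<in> section_centralizer G U V" using x(1) by (auto simp: section_centralizer_def)
  next
    fix x y assume "x \<in> section_centralizer G U V" "y \<in> section_centralizer G U V"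
    then have x: "x \<in> carrier G" "\<And>u. u \<in> U \<Longrightarrow> x \<otimes> u \<otimes> inv x \<otimes> inv u \<in> V"
      and y: "y \<in> carrier G" "\<And>u. u \<in> U \<Longrightarrow> y \<otimes> u \<otimes> inv y \<otimes> inv u \<in> V"
      by (auto simp: section_centralizer_def)
    have "x \<otimes> y \<otimes> u \<otimes> inv (x \<otimes> y) \<otimes> inv u \<in> V" if u: "u \<in> U" for u
    proof -
      \<comment> \<open>The identity behind this case is
        \<open>[x y, u] = [x, ?u] [y, u]\<close>.\<close>
      let ?u = "y \<otimes> u \<otimes> inv y"
      have uc: "u \<in> carrier G" using u by auto
      have "(x \<otimes> ?u \<otimes> inv x \<otimes> inv ?u) \<otimes> (?u \<otimes> inv u) \<in> V"
        by (rule V.m_closed[OF x(2)[OF U.inv_op_closed2[OF y(1) u]] y(2)[OF u]])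
      moreover have "(x \<otimes> ?u \<otimes> inv x \<otimes> inv ?u) \<otimes> (?u \<otimes> inv u) = x \<otimes> ?u \<otimes> inv x \<otimes> inv u"
        using x(1) y(1) uc by (simp add: m_assoc group_cancel inv_mult_group)
      ultimately have "x \<otimes> ?u \<otimes> inv x \<otimes> inv u \<in> V" by (simp only:)
      then show ?thesis using x(1) y(1) uc by (simp add: inv_mult_group m_assoc)
    qed
    then show "x \<otimes> y \<in> section_centralizer G U V"
      using x(1) y(1) by (auto simp: section_centralizer_def)
  qed
qed

lemma characteristic_section_centralizer:
  assumes "characteristic G U" "characteristic G V"
  shows "characteristic G (section_centralizer G U V)"
proof (rule characteristicI)
  show "subgroup (section_centralizer G U V) G"
    using assms by (intro subgroup_section_centralizer characteristic_normal)
  fix \<gamma> x assume g: "\<gamma> \<in> auto G" and x: "x \<in> section_centralizer G U V"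
  have xc: "x \<in> carrier G" using x by (simp add: section_centralizer_def)
  have "\<gamma> x \<otimes> u \<otimes> inv (\<gamma> x) \<otimes> inv u \<in> V" if u: "u \<in> U" for u
  proof -
    obtain w where w: "w \<in> U" "\<gamma> w = u" using characteristic_preimage[OF assms(1) g u] by auto
    have wc: "w \<in> carrier G" using subgroup.mem_carrier[OF characteristic_subgroup[OF assms(1)] w(1)] .
    have "\<gamma> (x \<otimes> w \<otimes> inv x \<otimes> inv w) \<in> V"
      using x w(1) by (intro characteristicD[OF assms(2) g]) (simp add: section_centralizer_def)
    then show ?thesis using auto_commutator[OF g xc wc] w(2) by simp
  qed
  then show "\<gamma> x \<in> section_centralizer G U V"
    using auto_closed[OF g xc] by (simp add: section_centralizer_def)
qed

lemma conj_coset: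
  assumes "N \<lhd> G" "x \<in> carrier G" "u \<in> carrier G"
  shows "(\<lambda>a. x \<otimes> a \<otimes> inv x) ` (N #> u) = N #> (x \<otimes> u \<otimes> inv x)"
proof -
  interpret N: normal N G by fact
  let ?c = "\<lambda>a. x \<otimes> a \<otimes> inv x"
  show ?thesis
  proof
    show "?c ` (N #> u) \<subseteq> N #> ?c u"
    proof
      fix a assume "a \<in> ?c ` (N #> u)"
      then obtain v where v: "v \<in> N" "a = ?c (v \<otimes> u)" by (auto simp: r_coset_def)
      then have "a = ?c v \<otimes> ?c u" using assms by (simp add: m_assoc group_cancel)
      then show "a \<in> N #> ?c u" using N.inv_op_closed2[OF assms(2) v(1)] by (auto simp: r_coset_def)
    qed
    show "N #> ?c u \<subseteq> ?c ` (N #> u)"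
    proof
      fix a assume "a \<in> N #> ?c u"
      then obtain v where v: "v \<in> N" "a = v \<otimes> ?c u" by (auto simp: r_coset_def)
      then have "a = ?c ((inv x \<otimes> v \<otimes> x) \<otimes> u)"
        using assms by (simp add: m_assoc group_cancel)
      then show "a \<in> ?c ` (N #> u)" using N.inv_op_closed1[OF assms(2) v(1)] by (auto simp: r_coset_def)
    qed
  qed
qed

text \<open>\<open>G\<close> acts by conjugation on the finite set \<open>?F\<close> of cosets; two
  elements acting in the same way differ by an element of the centralizer.\<close>

lemma finite_cosets_section_centralizer:
  assumes "U \<lhd> G" "V \<lhd> G" "finite ((\<lambda>u. V #> u) ` U)"
  shows "finite ((\<lambda>x. section_centralizer G U V #> x) ` carrier G)"
proof -
  interpret U: normal U G by fact
  interpret V: normal V G by fact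
  let ?F = "(\<lambda>u. V #> u) ` U" and ?c = "\<lambda>x a. x \<otimes> a \<otimes> inv x"
  note img = conj_coset[OF assms(2)]
  show ?thesis
  proof (rule finite_cosets_if_finite_image)
    show "subgroup (section_centralizer G U V) G" using assms by (intro subgroup_section_centralizer)
    have "(\<lambda>x. \<lambda>C\<in>?F. ?c x ` C) ` carrier G \<subseteq> ?F \<rightarrow>\<^sub>E ?F"
      using img U.inv_op_closed2 by auto
    then show "finite ((\<lambda>x. \<lambda>C\<in>?F. ?c x ` C) ` carrier G)"
      using assms(3) by (meson finite_PiE finite_subset)
  next
    fix x y assume x: "x \<in> carrier G" and y: "y \<in> carrier G"
      and eq: "(\<lambda>C\<in>?F. ?c x ` C) = (\<lambda>C\<in>?F. ?c y ` C)"
    have "x \<otimes> inv y \<otimes> u \<otimes> inv (x \<otimes> inv y) \<otimes> inv u \<in> V" if u: "u \<in> U" for u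
    proof -
      let ?u = "inv y \<otimes> u \<otimes> y"
      have uc: "u \<in> carrier G" using u by auto
      have "V #> ?u \<in> ?F" using U.inv_op_closed1[OF y u] by auto
      then have "?c x ` (V #> ?u) = ?c y ` (V #> ?u)" using fun_cong[OF eq, of "V #> ?u"] by simp
      then have "V #> ?c x ?u = V #> ?c y ?u" using x y uc by (simp add: img)
      moreover have "?c y ?u = u" using y uc by (simp add: m_assoc group_cancel)
      ultimately have "?c x ?u \<otimes> inv u \<in> V" using x y uc by (simp add: rcos_eq_iff[OF V.subgroup_axioms])
      then show ?thesis using x y uc by (simp add: m_assoc inv_mult_group)
    qed
    then show "x \<otimes> inv y \<in> section_centralizer G U V" using x y by (simp add: section_centralizer_def)
  qed auto
qed

end

section \<open>Consequences of having finitely many automorphism orbits\<close>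

lemma (in group) finite_orbit_representatives:
  assumes "finite (aut_orbits G)"
  shows "\<exists>F. finite F \<and> F \<subseteq> carrier G \<and> (\<forall>x\<in>carrier G. \<exists>\<gamma>\<in>auto G. \<exists>y\<in>F. \<gamma> y = x)"
proof -
  have o: "aut_orbits G = {{\<gamma> x |\<gamma>. \<gamma> \<in> auto G} |x. x \<in> carrier G}"
    by (simp add: aut_orbits_def orbits_def orbit_def AutoGroup_def)
  define F where "F = (\<lambda>A. SOME x. x \<in> A) ` aut_orbits G"
  have ne: "A \<noteq> {}" if "A \<in> aut_orbits G" for A using that id_in_auto by (auto simp: o)
  have some: "(SOME x. x \<in> A) \<in> A" if "A \<in> aut_orbits G" for A
    using ne[OF that] by (meson ex_in_conv someI_ex)
  have "F \<subseteq> carrier G"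
  proof
    fix y assume "y \<in> F"
    then obtain A where "A \<in> aut_orbits G" "y \<in> A" using some by (auto simp: F_def)
    then show "y \<in> carrier G" by (auto simp: o intro: auto_closed)
  qed
  moreover have "\<exists>\<gamma>\<in>auto G. \<exists>y\<in>F. \<gamma> y = x" if x: "x \<in> carrier G" for x
  proof -
    let ?A = "{\<gamma> x |\<gamma>. \<gamma> \<in> auto G}"
    have A: "?A \<in> aut_orbits G" using x by (auto simp: o)
    define y where "y = (SOME y. y \<in> ?A)"
    have "y \<in> ?A" unfolding y_def by (rule some[OF A])
    then obtain \<gamma> where g: "\<gamma> \<in> auto G" "y = \<gamma> x" by auto
    obtain \<delta> where d: "\<delta> \<in> auto G" "\<forall>x\<in>carrier G. \<delta> (\<gamma> x) = x \<and> \<gamma> (\<delta> x) = x"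
      using auto_inverse[OF g(1)] by blast
    have "y \<in> F" unfolding F_def y_def using A by blast
    then show ?thesis using d g x by auto
  qed
  ultimately show ?thesis using assms by (intro exI[of _ F]) (auto simp: F_def)
qed

text \<open>A characteristic subgroup is a union of orbits, so it is determined by its intersection
  with the finite set \<open>F\<close> of orbit representatives.\<close>

lemma (in group) finite_characteristic_subgroups:
  assumes "finite (aut_orbits G)"
  shows "finite {H. characteristic G H}"
proof -
  obtain F where F: "finite F" "F \<subseteq> carrier G" "\<forall>x\<in>carrier G. \<exists>\<gamma>\<in>auto G. \<exists>y\<in>F. \<gamma> y = x"
    using finite_orbit_representatives[OF assms] by blast
  have "H \<subseteq> K" if hk: "characteristic G H" "characteristic G K" "F \<inter> H = F \<inter> K" for H K
  proof
    fix x assume x: "x \<in> H"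
    then have "x \<in> carrier G" using hk(1) characteristic_subgroup subgroup.mem_carrier by fast
    then obtain \<gamma> y where g: "\<gamma> \<in> auto G" "y \<in> F" "\<gamma> y = x" using F(3) by blast
    obtain z where z: "z \<in> H" "\<gamma> z = x" using characteristic_preimage[OF hk(1) g(1) x] by auto
    have zc: "z \<in> carrier G" using subgroup.mem_carrier[OF characteristic_subgroup[OF hk(1)] z(1)] .
    have yc: "y \<in> carrier G" using g(2) F(2) by auto
    obtain \<delta> where d: "\<forall>x\<in>carrier G. \<delta> (\<gamma> x) = x \<and> \<gamma> (\<delta> x) = x"
      using auto_inverse[OF g(1)] by blast
    have "z = \<delta> (\<gamma> z)" using d zc by simp
    also have "\<dots> = \<delta> (\<gamma> y)" using z(2) g(3) by simp
    also have "\<dots> = y" using d yc by simp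
    finally have "y \<in> F \<inter> H" using z(1) g(2) by simp
    then have "y \<in> K" using hk(3) by auto
    then show "x \<in> K" using characteristicD[OF hk(2) g(1)] g(3) by auto
  qed
  then have "inj_on (\<lambda>H. F \<inter> H) {H. characteristic G H}"
    by (intro inj_onI) (simp add: subset_antisym)
  then show ?thesis
    by (rule inj_on_finite[of _ _ "Pow F"]) (use F in auto)
qed

section \<open>The least characteristic subgroup of finite index\<close>

context group
begin

lemma subgroup_nat_pow_closed: "subgroup H G \<Longrightarrow> x \<in> H \<Longrightarrow> x [^] (n::nat) \<in> H"
  by (induction n) (auto simp: subgroup.one_closed subgroup.m_closed)

lemma auto_coset:
  assumes "characteristic G N" "\<gamma> \<in> auto G" "u \<in> carrier G"
  shows "\<gamma> ` (N #> u) = N #> \<gamma> u"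
proof -
  interpret h: group_hom G G \<gamma> using assms(2) by (rule auto_group_hom)
  have N: "v \<in> carrier G" if "v \<in> N" for v
    using that subgroup.mem_carrier[OF characteristic_subgroup[OF assms(1)]] by auto
  show ?thesis
  proof
    show "\<gamma> ` (N #> u) \<subseteq> N #> \<gamma> u"
      using N assms(3) characteristicD[OF assms(1,2)] by (auto simp: r_coset_def)
    show "N #> \<gamma> u \<subseteq> \<gamma> ` (N #> u)"
    proof
      fix a assume "a \<in> N #> \<gamma> u"
      then obtain v where v: "v \<in> N" "a = v \<otimes> \<gamma> u" by (auto simp: r_coset_def)
      obtain w where w: "w \<in> N" "\<gamma> w = v" using characteristic_preimage[OF assms(1,2) v(1)] by auto
      then have "a = \<gamma> (w \<otimes> u)" using v N assms(3) by simp
      then show "a \<in> \<gamma> ` (N #> u)" using w by (auto simp: r_coset_def)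
    qed
  qed
qed

text \<open>Since \<open>x y = z y x\<close> and \<open>z\<close> commutes with \<open>x\<close>,
  moving each of the \<open>n\<close> factors \<open>x\<close> past \<open>y\<close> costs one
  factor \<open>z\<close>.\<close>

lemma commutator_pow:
  assumes "x \<in> carrier G" "y \<in> carrier G"
    and z: "z = x \<otimes> y \<otimes> inv x \<otimes> inv y" "x \<otimes> z = z \<otimes> x"
  shows "x [^] n \<otimes> y \<otimes> inv (x [^] n) \<otimes> inv y = z [^] (n::nat)"
proof -
  have zc: "z \<in> carrier G" using assms by simp
  have xy: "x \<otimes> y = z \<otimes> y \<otimes> x" using assms(1,2) by (simp add: z(1) m_assoc group_cancel)
  have "x [^] n \<otimes> y = z [^] n \<otimes> y \<otimes> x [^] n"
  proof (induction n)
    case (Suc n)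
    have "x [^] Suc n \<otimes> y = x [^] n \<otimes> (z \<otimes> y \<otimes> x)" using assms(1,2) xy by (simp add: m_assoc)
    also have "\<dots> = (x [^] n \<otimes> z) \<otimes> y \<otimes> x" using assms(1,2) zc by (simp add: m_assoc)
    also have "x [^] n \<otimes> z = z \<otimes> x [^] n" using group_commutes_pow[OF z(2) assms(1) zc] .
    also have "z \<otimes> x [^] n \<otimes> y \<otimes> x = z \<otimes> (x [^] n \<otimes> y) \<otimes> x" using assms(1,2) zc by (simp add: m_assoc)
    also have "\<dots> = (z \<otimes> z [^] n) \<otimes> y \<otimes> (x [^] n \<otimes> x)"
      unfolding Suc using assms(1,2) zc by (simp add: m_assoc)
    also have "z \<otimes> z [^] n = z [^] Suc n" using nat_pow_Suc2[OF zc] by metis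
    finally show ?case by simp
  qed (use assms in simp)
  then have "x [^] n \<otimes> y \<otimes> inv (x [^] n) \<otimes> inv y = (z [^] n \<otimes> y \<otimes> x [^] n) \<otimes> inv (x [^] n) \<otimes> inv y"
    by simp
  also have "\<dots> = z [^] n" using assms(1,2) zc by (simp add: m_assoc group_cancel)
  finally show ?thesis .
qed

lemma commutes_mod:
  assumes "N \<lhd> G" "x \<in> carrier G" "y \<in> carrier G" "x \<otimes> y \<otimes> inv x \<otimes> inv y \<in> N"
  shows "N #> (x \<otimes> y) = N #> (y \<otimes> x)"
  using assms normal_imp_subgroup[OF assms(1)]
  by (subst rcos_eq_iff) (auto simp: inv_mult_group m_assoc)

lemma commutator_pow_mod:
  assumes N: "N \<lhd> G" and xy: "x \<in> carrier G" "y \<in> carrier G"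
    and z: "z = x \<otimes> y \<otimes> inv x \<otimes> inv y" "x \<otimes> z \<otimes> inv x \<otimes> inv z \<in> N"
  shows "N #> (x [^] n \<otimes> y \<otimes> inv (x [^] n) \<otimes> inv y) = N #> z [^] (n::nat)"
proof -
  interpret N: normal N G by fact
  interpret h: group_hom G "G Mod N" "\<lambda>a. N #> a" by (rule N.group_hom_Mod)
  have zc: "z \<in> carrier G" using xy z by simp
  let ?m = "(\<otimes>\<^bsub>G Mod N\<^esub>)" and ?i = "m_inv (G Mod N)"
  have "?m (?m (?m ((N #> x) [^]\<^bsub>G Mod N\<^esub> n) (N #> y)) (?i ((N #> x) [^]\<^bsub>G Mod N\<^esub> n))) (?i (N #> y))
     = (N #> z) [^]\<^bsub>G Mod N\<^esub> n"
  proof (rule h.H.commutator_pow)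
    show "N #> z = ?m (?m (?m (N #> x) (N #> y)) (?i (N #> x))) (?i (N #> y))"
      using xy unfolding z(1) by (simp only: h.hom_mult h.hom_inv m_closed inv_closed)
    show "?m (N #> x) (N #> z) = ?m (N #> z) (N #> x)"
      using commutes_mod[OF N xy(1) zc z(2)] xy zc by (metis h.hom_mult)
  qed (use xy in \<open>auto simp del: mult_FactGroup\<close>)
  then show ?thesis using xy zc
    by (simp only: h.hom_nat_pow[symmetric] h.hom_mult[symmetric] h.hom_inv[symmetric]
        m_closed inv_closed nat_pow_closed)
qed

end

locale soluble_rank_orbits = group G for G (structure) +
  fixes r :: nat
  assumes soluble: "solvable G"
    and rank: "fg_subgroups_generated_by G r"
    and orbits: "finite (aut_orbits G)"
begin

text \<open>The subgroup \<open>R\<close> of the overview. Only finitely many subgroups are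
  intersected, by \<open>finite_characteristic_subgroups\<close>, so the intersection again has
  finite index.\<close>

definition res where
  "res = \<Inter>{H. characteristic G H \<and> finite ((\<lambda>x. H #> x) ` carrier G)}"

lemma res_characteristic_finite: "characteristic G res \<and> finite ((\<lambda>x. res #> x) ` carrier G)"
proof -
  let ?P = "\<lambda>H. characteristic G H \<and> finite ((\<lambda>x. H #> x) ` carrier G)"
  have fin: "finite {H. ?P H}"
    by (rule finite_subset[OF _ finite_characteristic_subgroups[OF orbits]]) auto
  have "(\<lambda>x. carrier G #> x) ` carrier G \<subseteq> {carrier G}"
    using coset_join2[OF _ subgroup_self] by auto
  then have ne: "{H. ?P H} \<noteq> {}"
    using characteristic_carrier finite_subset[of _ "{carrier G}"] by blast
  have "?P (\<Inter>\<H>)" if "finite \<H>" "\<H> \<noteq> {}" "\<And>H. H \<in> \<H> \<Longrightarrow> ?P H" for \<H>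
    using that
  proof (induction rule: finite_ne_induct)
    case (insert H \<H>)
    then have "?P H" "?P (\<Inter>\<H>)" by auto
    then have "?P (H \<inter> \<Inter>\<H>)"
      using characteristic_Int finite_cosets_Int characteristic_subgroup by auto
    then show ?case by simp
  qed auto
  from this[OF fin ne] show ?thesis unfolding res_def by simp
qed

lemma res_characteristic: "characteristic G res"
  using res_characteristic_finite by simp

lemma res_subgroup: "subgroup res G"
  using res_characteristic by (rule characteristic_subgroup)

lemma res_normal: "res \<lhd> G"
  using res_characteristic by (rule characteristic_normal)

lemma res_carrier: "x \<in> res \<Longrightarrow> x \<in> carrier G"
  using subgroup.mem_carrier[OF res_subgroup] .

lemma res_least:
  "characteristic G H \<Longrightarrow> finite ((\<lambda>x. H #> x) ` carrier G) \<Longrightarrow> res \<subseteq> H"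
  unfolding res_def by auto

text \<open>A subgroup with finitely many cosets in \<open>res\<close> has finite index in
  \<open>G\<close> by transitivity. Thus \<open>res\<close> has no proper subgroup of finite index
  that is characteristic in \<open>G\<close>.\<close>

lemma res_minimal:
  assumes "characteristic G H" "finite ((\<lambda>x. H #> x) ` res)"
  shows "res \<subseteq> H"
  using assms res_characteristic_finite finite_cosets_trans[of H res "carrier G"]
  by (intro res_least) (auto simp: characteristic_subgroup)

text \<open>The powers generate a characteristic subgroup, and modulo it \<open>res\<close> has
  bounded exponent; so its index in \<open>res\<close> is finite and minimality applies.\<close>

lemma res_generated_by_powers:
  assumes "0 < (n::nat)"
  shows "generate G ((\<lambda>x. x [^] n) ` res) = res"
proof
  have sub: "(\<lambda>x. x [^] n) ` res \<subseteq> res"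
    using subgroup_nat_pow_closed[OF res_subgroup] by auto
  then show "generate G ((\<lambda>x. x [^] n) ` res) \<subseteq> res"
    by (rule generate_subgroup_incl[OF _ res_subgroup])
  have c: "characteristic G (generate G ((\<lambda>x. x [^] n) ` res))"
  proof (rule characteristic_generate)
    show "(\<lambda>x. x [^] n) ` res \<subseteq> carrier G" using res_carrier by auto
    fix \<gamma> x assume g: "\<gamma> \<in> auto G" and "x \<in> (\<lambda>x. x [^] n) ` res"
    then obtain y where y: "y \<in> res" "x = y [^] n" by auto
    interpret h: group_hom G G \<gamma> using g by (rule auto_group_hom)
    have "\<gamma> x = \<gamma> y [^] n" using y res_carrier h.hom_nat_pow by auto
    then show "\<gamma> x \<in> generate G ((\<lambda>x. x [^] n) ` res)"
      using characteristicD[OF res_characteristic g y(1)] by (intro generate.incl) auto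
  qed
  have "finite ((\<lambda>x. generate G ((\<lambda>x. x [^] n) ` res) #> x) ` res)"
    by (rule finite_cosets_bounded_exponent[OF soluble rank assms characteristic_normal[OF c] res_subgroup])
      (auto intro: generate.incl)
  then show "res \<subseteq> generate G ((\<lambda>x. x [^] n) ` res)"
    using c by (rule res_minimal[rotated])
qed

text \<open>The centralizer of a finite characteristic section is itself characteristic and of
  finite index, hence contains \<open>res\<close>.\<close>

lemma res_centralizes_finite:
  assumes "characteristic G U" "characteristic G V" "finite ((\<lambda>u. V #> u) ` U)"
  shows "res \<subseteq> section_centralizer G U V"
  by (intro res_least characteristic_section_centralizer finite_cosets_section_centralizer
      characteristic_normal assms)

end

section \<open>Torsion-free chief sections\<close>

lemma (in group) comm_group_section:
  assumes "subgroup L G" "M \<lhd> G" "M \<subseteq> L" "derived G L \<subseteq> M"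
  shows "comm_group (G\<lparr>carrier := L\<rparr> Mod M)"
proof -
  interpret N: normal M "G\<lparr>carrier := L\<rparr>"
    by (rule normal_restrict_supergroup[OF assms(1,2,3)])
  have LG: "a \<in> carrier G" if "a \<in> L" for a using assms(1) that subgroup.mem_carrier by fast
  show ?thesis
  proof (rule group.group_comm_groupI[OF N.factorgroup_is_group])
    fix A B assume "A \<in> carrier (G\<lparr>carrier := L\<rparr> Mod M)" "B \<in> carrier (G\<lparr>carrier := L\<rparr> Mod M)"
    then obtain a b where ab: "a \<in> L" "b \<in> L" "A = M #> a" "B = M #> b"
      by (auto simp: carrier_FactGroup)
    have "a \<otimes> b \<otimes> inv a \<otimes> inv b \<in> derived G L"
      unfolding derived_def using ab by (intro generate.incl) auto
    then have "M #> (a \<otimes> b) = M #> (b \<otimes> a)"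
      using assms(4) ab LG by (intro commutes_mod[OF assms(2)]) auto
    then show "A \<otimes>\<^bsub>G\<lparr>carrier := L\<rparr> Mod M\<^esub> B = B \<otimes>\<^bsub>G\<lparr>carrier := L\<rparr> Mod M\<^esub> A"
      using N.rcos_sum[of a b] N.rcos_sum[of b a] ab by simp
  qed
qed

text \<open>The situation met in \<open>res_series_trivial\<close> when \<open>L / M\<close> has
  unbounded exponent. Chief refers to the action of the full automorphism group, not only to
  conjugation.\<close>

locale torsion_free_chief_section = soluble_rank_orbits +
  fixes L M
  assumes L: "characteristic G L" and M: "characteristic G M"
    and MsubL: "M \<subseteq> L" "M \<noteq> L" and abelian: "derived G L \<subseteq> M"
    and torsion_free_section: "\<And>x n. x \<in> L \<Longrightarrow> 0 < (n::nat) \<Longrightarrow> x [^] n \<in> M \<Longrightarrow> x \<in> M"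
    and chief: "\<And>H. characteristic G H \<Longrightarrow> M \<subseteq> H \<Longrightarrow> H \<subseteq> L \<Longrightarrow> H = M \<or> H = L"
begin

abbreviation A where "A \<equiv> G\<lparr>carrier := L\<rparr> Mod M"

text \<open>Elements of \<open>A\<close> are cosets as sets, so conjugation acts on them by taking
  images, without choosing representatives; automorphisms act in the same way through
  \<open>image \<gamma>\<close>.\<close>

definition conj_on where "conj_on x U = (\<lambda>a. x \<otimes> a \<otimes> inv x) ` U"

lemma L_subgroup: "subgroup L G" and M_subgroup: "subgroup M G"
  and L_normal: "L \<lhd> G" and M_normal: "M \<lhd> G"
  using L M characteristic_subgroup characteristic_normal by auto

lemma L_carrier: "a \<in> L \<Longrightarrow> a \<in> carrier G"
  using subgroup.mem_carrier[OF L_subgroup] .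

sublocale N: normal M "G\<lparr>carrier := L\<rparr>"
  by (rule normal_restrict_supergroup[OF L_subgroup M_normal MsubL(1)])

sublocale A: comm_group A
  by (rule comm_group_section[OF L_subgroup M_normal MsubL(1) abelian])

lemma carrier_A: "carrier A = (\<lambda>a. M #> a) ` L"
  by (simp add: carrier_FactGroup)

lemma mult_A: "a \<in> L \<Longrightarrow> b \<in> L \<Longrightarrow> (M #> a) \<otimes>\<^bsub>A\<^esub> (M #> b) = M #> (a \<otimes> b)"
  using N.rcos_sum[of a b] by simp

lemma coset_eq_one_iff: "a \<in> L \<Longrightarrow> M #> a = \<one>\<^bsub>A\<^esub> \<longleftrightarrow> a \<in> M"
  using coset_join1[OF _ L_carrier M_subgroup] coset_join2[OF L_carrier M_subgroup] by auto

lemma isolated_A: "isolated A {\<one>\<^bsub>A\<^esub>}"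
  unfolding isolated_def
proof (intro conjI ballI allI impI)
  show "subgroup {\<one>\<^bsub>A\<^esub>} A" by (rule A.triv_subgroup)
  fix U and n :: nat assume U: "U \<in> carrier A" and n: "0 < n \<and> U [^]\<^bsub>A\<^esub> n \<in> {\<one>\<^bsub>A\<^esub>}"
  obtain a where a: "a \<in> L" "U = M #> a" using U carrier_A by auto
  have "U [^]\<^bsub>A\<^esub> n = M #> (a [^]\<^bsub>G\<lparr>carrier := L\<rparr>\<^esub> n)" using N.FactGroup_pow[of a n] a by simp
  also have "a [^]\<^bsub>G\<lparr>carrier := L\<rparr>\<^esub> n = a [^] n" using nat_pow_consistent by metis
  finally have "M #> (a [^] n) = \<one>\<^bsub>A\<^esub>" using n by simp
  then have "a [^] n \<in> M"
    using coset_eq_one_iff subgroup_nat_pow_closed[OF L_subgroup a(1)] by blast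
  then have "a \<in> M" using torsion_free_section[OF a(1)] n by blast
  then show "U \<in> {\<one>\<^bsub>A\<^esub>}" using a coset_eq_one_iff by simp
qed

lemma rank_A: "fg_subgroups_generated_by A r"
  by (intro N.fg_subgroups_generated_by_Mod fg_subgroups_generated_by_subgroup L_subgroup rank)

lemma L_conj: "x \<in> carrier G \<Longrightarrow> a \<in> L \<Longrightarrow> x \<otimes> a \<otimes> inv x \<in> L"
  using normal.inv_op_closed2[OF L_normal] .

lemma conj_on_coset: "x \<in> carrier G \<Longrightarrow> a \<in> L \<Longrightarrow> conj_on x (M #> a) = M #> (x \<otimes> a \<otimes> inv x)"
  unfolding conj_on_def by (rule conj_coset[OF M_normal _ L_carrier])

lemma conj_on_hom: "x \<in> carrier G \<Longrightarrow> conj_on x \<in> hom A A"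
proof (rule homI)
  fix U assume x: "x \<in> carrier G" and U: "U \<in> carrier A"
  then show "conj_on x U \<in> carrier A" using L_conj by (auto simp: carrier_A conj_on_coset)
  fix W assume W: "W \<in> carrier A"
  obtain a b where ab: "a \<in> L" "b \<in> L" "U = M #> a" "W = M #> b" using U W carrier_A by auto
  have "x \<otimes> (a \<otimes> b) \<otimes> inv x = (x \<otimes> a \<otimes> inv x) \<otimes> (x \<otimes> b \<otimes> inv x)"
    using x ab L_carrier by (simp add: m_assoc group_cancel)
  then show "conj_on x (U \<otimes>\<^bsub>A\<^esub> W) = conj_on x U \<otimes>\<^bsub>A\<^esub> conj_on x W"
    using x ab L_conj subgroup.m_closed[OF L_subgroup]
    by (simp add: mult_A conj_on_coset del: mult_FactGroup)
qed

lemma conj_on_mult: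
  assumes "x \<in> carrier G" "y \<in> carrier G" "U \<in> carrier A"
  shows "conj_on (x \<otimes> y) U = conj_on x (conj_on y U)"
proof -
  obtain a where a: "a \<in> L" "U = M #> a" using assms(3) carrier_A by auto
  have "x \<otimes> y \<otimes> a \<otimes> inv (x \<otimes> y) = x \<otimes> (y \<otimes> a \<otimes> inv y) \<otimes> inv x"
    using assms a L_carrier by (simp add: m_assoc inv_mult_group)
  then show ?thesis using assms a L_conj by (simp add: conj_on_coset)
qed

lemma conj_on_one: "U \<in> carrier A \<Longrightarrow> conj_on \<one> U = U"
  using L_carrier by (auto simp: carrier_A conj_on_coset)

lemma conj_on_inj: "x \<in> carrier G \<Longrightarrow> inj_on (conj_on x) (carrier A)"
  by (rule inj_on_inverseI[of _ "conj_on (inv x)"]) (simp flip: conj_on_mult add: conj_on_one)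

lemma conj_on_pow: "x \<in> carrier G \<Longrightarrow> U \<in> carrier A \<Longrightarrow> (conj_on x ^^ k) U = conj_on (x [^] k) U"
proof (induction k arbitrary: U)
  case (Suc k)
  then have "(conj_on x ^^ Suc k) U = conj_on (x [^] k) (conj_on x U)"
    using A.endo_closed[OF conj_on_hom] by (simp add: funpow_Suc_right del: funpow.simps)
  also have "\<dots> = conj_on (x [^] Suc k) U" using Suc.prems by (simp add: conj_on_mult)
  finally show ?case .
qed (simp add: conj_on_one)

lemma auto_hom_A:
  assumes "\<gamma> \<in> auto G"
  shows "image \<gamma> \<in> hom A A"
proof (rule homI)
  interpret h: group_hom G G \<gamma> using assms by (rule auto_group_hom)
  fix U assume U: "U \<in> carrier A"
  then show "\<gamma> ` U \<in> carrier A"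
    using auto_coset[OF M assms L_carrier] characteristicD[OF L assms] by (auto simp: carrier_A)
  fix W assume W: "W \<in> carrier A"
  obtain a b where ab: "a \<in> L" "b \<in> L" "U = M #> a" "W = M #> b" using U W carrier_A by auto
  then show "\<gamma> ` (U \<otimes>\<^bsub>A\<^esub> W) = \<gamma> ` U \<otimes>\<^bsub>A\<^esub> \<gamma> ` W"
    using L_carrier subgroup.m_closed[OF L_subgroup] characteristicD[OF L assms]
    by (simp add: mult_A auto_coset[OF M assms] del: mult_FactGroup)
qed

lemma auto_conj_on:
  assumes "\<gamma> \<in> auto G" "x \<in> carrier G" "U \<in> carrier A"
  shows "\<gamma> ` conj_on x U = conj_on (\<gamma> x) (\<gamma> ` U)"
proof -
  interpret h: group_hom G G \<gamma> using assms(1) by (rule auto_group_hom)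
  obtain a where a: "a \<in> L" "U = M #> a" using assms(3) carrier_A by auto
  then show ?thesis
    using assms L_carrier L_conj characteristicD[OF L assms(1)]
    by (simp add: conj_on_coset auto_coset[OF M assms(1)])
qed

lemma auto_surj_A:
  assumes "\<gamma> \<in> auto G" "U \<in> carrier A"
  shows "\<exists>W\<in>carrier A. \<gamma> ` W = U"
proof -
  obtain a where a: "a \<in> L" "U = M #> a" using assms(2) carrier_A by auto
  obtain b where b: "b \<in> L" "\<gamma> b = a" using characteristic_preimage[OF L assms(1) a(1)] by auto
  then have "\<gamma> ` (M #> b) = U" using auto_coset[OF M assms(1) L_carrier[OF b(1)]] a by simp
  then show ?thesis using b(1) carrier_A by auto
qed

text \<open>Annihilating polynomials are constant along orbits, so finitely many orbits
  yield one polynomial for all elements of the group.\<close>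

lemma uniform_annihilator:
  "\<exists>f. f \<noteq> 0 \<and> (\<forall>x\<in>carrier G. \<forall>U\<in>carrier A. poly_act A (conj_on x) f U = \<one>\<^bsub>A\<^esub>)"
proof -
  obtain F where F: "finite F" "F \<subseteq> carrier G" "\<forall>x\<in>carrier G. \<exists>\<gamma>\<in>auto G. \<exists>y\<in>F. \<gamma> y = x"
    using finite_orbit_representatives[OF orbits] by blast
  have "\<forall>y\<in>F. \<exists>f. f \<noteq> 0 \<and> (\<forall>U\<in>carrier A. poly_act A (conj_on y) f U = \<one>\<^bsub>A\<^esub>)"
    using A.exists_annihilator[OF rank_A conj_on_hom isolated_A] F(2) by blast
  then obtain f where f: "\<And>y. y \<in> F \<Longrightarrow> f y \<noteq> 0"
    "\<And>y U. y \<in> F \<Longrightarrow> U \<in> carrier A \<Longrightarrow> poly_act A (conj_on y) (f y) U = \<one>\<^bsub>A\<^esub>"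
    by metis
  have "poly_act A (conj_on x) (prod f F) U = \<one>\<^bsub>A\<^esub>"
    if x: "x \<in> carrier G" and U: "U \<in> carrier A" for x U
  proof -
    obtain \<gamma> y where g: "\<gamma> \<in> auto G" "y \<in> F" "\<gamma> y = x" using F(3) x by blast
    obtain W where W: "W \<in> carrier A" "\<gamma> ` W = U" using auto_surj_A[OF g(1) U] by auto
    have yc: "y \<in> carrier G" using g F by auto
    have "\<gamma> ` poly_act A (conj_on y) (f y) W = poly_act A (conj_on x) (f y) (\<gamma> ` W)"
      by (rule A.poly_act_commute[OF conj_on_hom[OF yc] W(1) A.comm_group_axioms
            conj_on_hom[OF x] auto_hom_A[OF g(1)]])
        (use auto_conj_on[OF g(1) yc] g(3) in simp)
    then have "poly_act A (conj_on x) (f y) U = \<gamma> ` \<one>\<^bsub>A\<^esub>" using f(2)[OF g(2) W(1)] W(2) by simp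
    also have "\<dots> = \<one>\<^bsub>A\<^esub>" by (rule hom_one[OF auto_hom_A[OF g(1)]]) auto
    finally have one: "poly_act A (conj_on x) (f y) U = \<one>\<^bsub>A\<^esub>" .
    have "prod f F = prod f (F - {y}) * f y" using F(1) g(2) by (simp add: prod.remove mult.commute)
    then show ?thesis using one A.poly_act_mult[OF conj_on_hom[OF x] U]
        A.endo_one[OF A.poly_act_hom[OF conj_on_hom[OF x]]] by simp
  qed
  moreover have "prod f F \<noteq> 0" using f(1) F(1) by simp
  ultimately show ?thesis by blast
qed

section \<open>The centralizer of \<open>L / M\<close>\<close>

abbreviation C where "C \<equiv> section_centralizer G L M"

lemma C_characteristic: "characteristic G C"
  by (intro characteristic_section_centralizer L M)

lemma C_subgroup: "subgroup C G" and C_normal: "C \<lhd> G"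
  using C_characteristic characteristic_subgroup characteristic_normal by auto

lemma conj_on_C: "x \<in> C \<Longrightarrow> U \<in> carrier A \<Longrightarrow> conj_on x U = U"
proof -
  assume x: "x \<in> C" and "U \<in> carrier A"
  then obtain a where a: "a \<in> L" "U = M #> a" using carrier_A by auto
  have xc: "x \<in> carrier G" using x by (simp add: section_centralizer_def)
  have "x \<otimes> a \<otimes> inv x \<otimes> inv a \<in> M" using x a by (simp add: section_centralizer_def)
  then have "M #> (x \<otimes> a \<otimes> inv x) = M #> a"
    using xc a L_carrier by (subst rcos_eq_iff[OF M_subgroup]) auto
  then show ?thesis using a xc by (simp add: conj_on_coset)
qed

text \<open>Modulo \<open>C\<close> the group \<open>D\<close> is abelian, so it acts on
  \<open>A\<close> by commuting operators. Their \<open>N\<close>-th powers have a nontrivial common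
  fixed point, and the fixed points form a characteristic subgroup above \<open>M\<close>, which
  must be all of \<open>L\<close> because the section is chief.\<close>

lemma power_centralizes:
  assumes D: "characteristic G D"
    and comm: "\<And>x y. x \<in> D \<Longrightarrow> y \<in> D \<Longrightarrow> x \<otimes> y \<otimes> inv x \<otimes> inv y \<in> C"
  shows "\<exists>N>0. \<forall>x\<in>D. x [^] (N::nat) \<in> C"
proof -
  have Dc: "x \<in> carrier G" if "x \<in> D" for x
    using that subgroup.mem_carrier[OF characteristic_subgroup[OF D]] by auto
  obtain f where f: "f \<noteq> 0"
    "\<And>x U. x \<in> carrier G \<Longrightarrow> U \<in> carrier A \<Longrightarrow> poly_act A (conj_on x) f U = \<one>\<^bsub>A\<^esub>"
    using uniform_annihilator by blast
  have nt: "carrier A \<noteq> {\<one>\<^bsub>A\<^esub>}"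
  proof
    assume "carrier A = {\<one>\<^bsub>A\<^esub>}"
    then have "M #> a = \<one>\<^bsub>A\<^esub>" if "a \<in> L" for a
      using that unfolding carrier_A by blast
    then show False using MsubL coset_eq_one_iff by blast
  qed
  have "\<exists>N>0. \<exists>U\<in>carrier A. U \<noteq> \<one>\<^bsub>A\<^esub> \<and> (\<forall>\<phi>\<in>conj_on ` D. (\<phi> ^^ N) U = U)"
  proof (rule A.exists_common_fixed_point[OF rank_A isolated_A nt _ _ _ f(1)])
    fix \<phi> assume "\<phi> \<in> conj_on ` D"
    then obtain x where x: "x \<in> D" "\<phi> = conj_on x" by auto
    show h: "\<phi> \<in> hom A A" and "inj_on \<phi> (carrier A)" using x Dc conj_on_hom conj_on_inj by auto
    {
      fix \<psi> U assume "\<psi> \<in> conj_on ` D" and U: "U \<in> carrier A"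
      then obtain y where y: "y \<in> D" "\<psi> = conj_on y" by auto
      \<comment> \<open>The elements \<open>x\<close> and \<open>y\<close> may fail to commute, but
        their commutator lies in \<open>C\<close> and acts trivially on \<open>A\<close>.\<close>
      let ?c = "x \<otimes> y \<otimes> inv x \<otimes> inv y"
      have "x \<otimes> y = ?c \<otimes> (y \<otimes> x)" using x y Dc by (simp add: m_assoc group_cancel)
      then have "conj_on (x \<otimes> y) U = conj_on ?c (conj_on (y \<otimes> x) U)"
        using x y Dc U conj_on_mult[of ?c "y \<otimes> x" U] by simp
      also have "\<dots> = conj_on (y \<otimes> x) U"
        using x y Dc U by (intro conj_on_C comm A.endo_closed[OF conj_on_hom]) auto
      finally show "\<phi> (\<psi> U) = \<psi> (\<phi> U)" using x y Dc U by (simp add: conj_on_mult)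
    next
      fix k U assume U: "U \<in> carrier A"
      \<comment> \<open>Here the uniformity of \<open>f\<close> is used: \<open>\<phi> ^^ k\<close>
        is conjugation by \<open>x [^] k\<close>, which is annihilated by the same
        \<open>f\<close>.\<close>
      have "poly_act A (\<phi> ^^ k) f U = poly_act A (conj_on (x [^] k)) f U"
        using x Dc U h by (intro A.poly_act_cong) (auto simp: A.endo_funpow conj_on_hom conj_on_pow)
      then show "poly_act A (\<phi> ^^ k) f U = \<one>\<^bsub>A\<^esub>" using f(2) x Dc U by simp
    }
  qed
  then obtain N U where NU: "0 < N" "U \<in> carrier A" "U \<noteq> \<one>\<^bsub>A\<^esub>"
    "\<And>x. x \<in> D \<Longrightarrow> (conj_on x ^^ N) U = U" by auto
  obtain a where a: "a \<in> L" "U = M #> a" using NU(2) carrier_A by auto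
  \<comment> \<open>\<open>B\<close> is the preimage in \<open>L\<close> of the common fixed points.
    It is characteristic because automorphisms permute the \<open>N\<close>-th powers of elements of
    \<open>D\<close>.\<close>
  define B where "B = {b\<in>L. \<forall>x\<in>D. conj_on (x [^] N) (M #> b) = M #> b}"
  have cB: "characteristic G B"
  proof (rule characteristicI)
    show "subgroup B G"
    proof (rule subgroup.intro)
      show "B \<subseteq> carrier G" using L_carrier by (auto simp: B_def)
      fix b c assume bc: "b \<in> B" "c \<in> B"
      have "conj_on (x [^] N) (M #> (b \<otimes> c)) = M #> (b \<otimes> c)" if x: "x \<in> D" for x
      proof -
        interpret h: group_hom A A "conj_on (x [^] N)"
          using conj_on_hom Dc x by unfold_locales auto
        have "conj_on (x [^] N) ((M #> b) \<otimes>\<^bsub>A\<^esub> (M #> c)) = (M #> b) \<otimes>\<^bsub>A\<^esub> (M #> c)"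
          using bc x by (subst h.hom_mult) (auto simp: B_def carrier_A)
        then show ?thesis using bc by (simp add: mult_A B_def del: mult_FactGroup)
      qed
      then show "b \<otimes> c \<in> B" using bc subgroup.m_closed[OF L_subgroup] by (simp add: B_def)
    next
      have "conj_on (x [^] N) (M #> \<one>) = M #> \<one>" if x: "x \<in> D" for x
        using conj_on_coset[of "x [^] N" \<one>] Dc[OF x] subgroup.one_closed[OF L_subgroup] by simp
      then show "\<one> \<in> B" using subgroup.one_closed[OF L_subgroup] by (simp add: B_def)
    next
      fix b assume b: "b \<in> B"
      have "conj_on (x [^] N) (M #> inv b) = M #> inv b" if x: "x \<in> D" for x
      proof -
        interpret h: group_hom A A "conj_on (x [^] N)"
          using conj_on_hom Dc x by unfold_locales auto
        have bL: "b \<in> L" using b by (simp add: B_def)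
        have cA: "M #> b \<in> carrier A" "M #> inv b \<in> carrier A"
          using bL subgroup.m_inv_closed[OF L_subgroup bL] by (auto simp: carrier_A)
        have "(M #> inv b) \<otimes>\<^bsub>A\<^esub> (M #> b) = \<one>\<^bsub>A\<^esub>"
          using bL subgroup.m_inv_closed[OF L_subgroup bL] L_carrier subgroup.subset[OF M_subgroup]
          by (simp add: mult_A del: mult_FactGroup)
        then have "M #> inv b = inv\<^bsub>A\<^esub> (M #> b)" using cA by (metis A.inv_equality)
        then show ?thesis using h.hom_inv[OF cA(1)] b x by (simp add: B_def)
      qed
      then show "inv b \<in> B" using b subgroup.m_inv_closed[OF L_subgroup] by (simp add: B_def)
    qed
    fix \<gamma> b assume g: "\<gamma> \<in> auto G" and b: "b \<in> B"
    interpret h: group_hom G G \<gamma> using g by (rule auto_group_hom)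
    have bL: "b \<in> L" using b by (simp add: B_def)
    have "conj_on (x [^] N) (M #> \<gamma> b) = M #> \<gamma> b" if x: "x \<in> D" for x
    proof -
      obtain y where y: "y \<in> D" "\<gamma> y = x" using characteristic_preimage[OF D g x] by auto
      have "conj_on (x [^] N) (\<gamma> ` (M #> b)) = \<gamma> ` conj_on (y [^] N) (M #> b)"
        using auto_conj_on[OF g, of "y [^] N" "M #> b"] y Dc bL h.hom_nat_pow[of y N]
        by (auto simp: carrier_A)
      also have "\<dots> = \<gamma> ` (M #> b)" using b y(1) by (simp add: B_def)
      finally show ?thesis using auto_coset[OF M g L_carrier[OF bL]] by simp
    qed
    then show "\<gamma> b \<in> B" using characteristicD[OF L g bL] by (simp add: B_def)
  qed
  have "M \<subseteq> B"
  proof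
    fix b assume b: "b \<in> M"
    then have bL: "b \<in> L" using MsubL by auto
    have "M #> b = \<one>\<^bsub>A\<^esub>" using coset_eq_one_iff[OF bL] b by blast
    moreover have "conj_on (x [^] N) \<one>\<^bsub>A\<^esub> = \<one>\<^bsub>A\<^esub>" if "x \<in> D" for x
      by (rule A.endo_one[OF conj_on_hom]) (use that Dc in auto)
    ultimately show "b \<in> B" using bL by (simp add: B_def)
  qed
  moreover have "a \<in> B" using a NU(2,4) Dc conj_on_pow by (auto simp: B_def)
  moreover have "a \<notin> M" using a NU(3) coset_eq_one_iff by auto
  moreover have "B \<subseteq> L" by (auto simp: B_def)
  ultimately have BL: "B = L" using chief[OF cB] by blast
  have "x [^] N \<in> C" if x: "x \<in> D" for x
  proof -
    have xc: "x [^] N \<in> carrier G" using Dc[OF x] by simp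
    have "x [^] N \<otimes> b \<otimes> inv (x [^] N) \<otimes> inv b \<in> M" if b: "b \<in> L" for b
    proof -
      have "b \<in> B" using BL b by simp
      then have "M #> (x [^] N \<otimes> b \<otimes> inv (x [^] N)) = M #> b"
        using x conj_on_coset[OF xc b] by (simp add: B_def)
      then show ?thesis using xc L_carrier[OF b] rcos_eq_iff[OF M_subgroup] by simp
    qed
    then show ?thesis using xc by (simp add: section_centralizer_def)
  qed
  then show ?thesis using NU(1) by blast
qed

end

section \<open>Nilpotency and radicability\<close>

lemma (in group) section_centralizer_swap:
  assumes "subgroup V G" "U \<subseteq> carrier G" "W \<subseteq> section_centralizer G U V"
  shows "U \<subseteq> section_centralizer G W V"
proof
  fix u assume u: "u \<in> U"
  have "u \<otimes> w \<otimes> inv u \<otimes> inv w \<in> V" if w: "w \<in> W" for w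
  proof -
    have wc: "w \<in> carrier G" "w \<otimes> u \<otimes> inv w \<otimes> inv u \<in> V"
      using assms(3) w u by (auto simp: section_centralizer_def)
    have "u \<in> carrier G" using u assms(2) by auto
    then show ?thesis using inv_commutator[of w u] subgroup.m_inv_closed[OF assms(1) wc(2)] wc(1) by simp
  qed
  then show "u \<in> section_centralizer G W V" using u assms(2) by (auto simp: section_centralizer_def)
qed

context torsion_free_chief_section
begin

text \<open>Solubility is used here: \<open>Z\<close>, the part of \<open>res\<close> central modulo
  \<open>C\<close>, absorbs the derived series of \<open>res\<close> from the bottom up. Then
  \<open>power_centralizes\<close> puts all \<open>N'\<close>-th powers of \<open>res\<close> into
  \<open>C\<close>, and these generate \<open>res\<close>.\<close>

lemma res_centralizes: "res \<subseteq> C"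
proof -
  define Z where "Z = res \<inter> section_centralizer G res C"
  have Z: "characteristic G Z"
    unfolding Z_def by (intro characteristic_Int res_characteristic characteristic_section_centralizer C_characteristic)
  obtain N' where N': "0 < N'" "\<And>x. x \<in> Z \<Longrightarrow> x [^] (N'::nat) \<in> C"
    using power_centralizes[OF Z] by (auto simp: Z_def section_centralizer_def[of G res])
  \<comment> \<open>If the commutators of \<open>E\<close> lie in \<open>Z\<close>, they are central
    modulo \<open>C\<close>, so \<open>[x^N', y]\<close> agrees with \<open>[x, y]^N'\<close> modulo
    \<open>C\<close> and is trivial. Thus \<open>N'\<close>-th powers fall into \<open>W\<close>,
    the centre of \<open>E\<close> modulo \<open>C\<close>, and a further \<open>N\<close>-th power
    into \<open>C\<close>.\<close>
  have step: "E \<subseteq> Z" if E: "characteristic G E" "E \<subseteq> res" "derived G E \<subseteq> Z" for E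
  proof -
    have Es: "subgroup E G" using E(1) by (rule characteristic_subgroup)
    define W where "W = E \<inter> section_centralizer G E C"
    have W: "characteristic G W"
      unfolding W_def by (intro characteristic_Int E characteristic_section_centralizer C_characteristic)
    obtain N where N: "0 < N" "\<And>x. x \<in> W \<Longrightarrow> x [^] (N::nat) \<in> C"
      using power_centralizes[OF W] by (auto simp: W_def section_centralizer_def[of G E])
    have "x [^] (N' * N) \<in> C" if x: "x \<in> E" for x
    proof -
      have xc: "x \<in> carrier G" using subgroup.mem_carrier[OF Es x] .
      have "x [^] N' \<otimes> y \<otimes> inv (x [^] N') \<otimes> inv y \<in> C" if y: "y \<in> E" for y
      proof -
        define z where "z = x \<otimes> y \<otimes> inv x \<otimes> inv y"
        have yc: "y \<in> carrier G" using subgroup.mem_carrier[OF Es y] .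
        have "z \<in> derived G E" unfolding z_def derived_def using x y by (intro generate.incl) auto
        then have z: "z \<in> Z" using E(3) by auto
        have zc: "z \<in> carrier G" using z_def xc yc by simp
        have "z \<otimes> x \<otimes> inv z \<otimes> inv x \<in> C" using z x E(2) by (auto simp: Z_def section_centralizer_def[of G res])
        then have "x \<otimes> z \<otimes> inv x \<otimes> inv z \<in> C"
          using inv_commutator[OF zc xc] subgroup.m_inv_closed[OF C_subgroup] by metis
        then have eq: "C #> (x [^] N' \<otimes> y \<otimes> inv (x [^] N') \<otimes> inv y) = C #> z [^] N'"
          by (rule commutator_pow_mod[OF C_normal xc yc z_def])
        also have "\<dots> = C" using N'(2)[OF z] zc by (intro coset_join2 C_subgroup) auto
        finally show ?thesis using xc yc by (intro coset_join1[OF _ _ C_subgroup]) auto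
      qed
      then have "x [^] N' \<in> W"
        using xc subgroup_nat_pow_closed[OF Es x] by (simp add: W_def section_centralizer_def[of G E])
      then show ?thesis using N(2) nat_pow_pow[OF xc] by metis
    qed
    \<comment> \<open>Bounded exponent makes \<open>E\<close> finite modulo \<open>C\<close>; hence
      \<open>res\<close> centralizes it modulo \<open>C\<close>, which is what membership in
      \<open>Z\<close> means.\<close>
    then have "finite ((\<lambda>x. C #> x) ` E)"
      using N(1) N'(1) by (intro finite_cosets_bounded_exponent[OF soluble rank _ C_normal Es, of "N' * N"]) auto
    then have "res \<subseteq> section_centralizer G E C"
      by (rule res_centralizes_finite[OF E(1) C_characteristic])
    then have "E \<subseteq> section_centralizer G res C"
      by (rule section_centralizer_swap[OF C_subgroup subgroup.subset[OF Es]])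
    then show ?thesis using E(2) by (auto simp: Z_def)
  qed
  have "E \<subseteq> Z" if "characteristic G E" "E \<subseteq> res" "(derived G ^^ n) E \<subseteq> Z" for n E
    using that
  proof (induction n arbitrary: E)
    case (Suc n)
    have dE: "derived G E \<subseteq> E" by (rule derived_incl[OF subset_refl characteristic_subgroup[OF Suc.prems(1)]])
    have "derived G E \<subseteq> Z"
    proof (rule Suc.IH[of "derived G E"])
      show "characteristic G (derived G E)" by (rule characteristic_derived[OF Suc.prems(1)])
      show "(derived G ^^ n) (derived G E) \<subseteq> Z" using Suc.prems(3) by (simp add: funpow_swap1)
    qed (use Suc.prems(2) dE in blast)
    then show ?case using step Suc.prems by blast
  qed simp
  moreover obtain n where n: "(derived G ^^ n) (carrier G) = {\<one>}"
    using soluble solvable_iff_trivial_derived_seq by auto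
  have "(derived G ^^ n) res \<subseteq> {\<one>}" using mono_exp_of_derived[OF subgroup.subset[OF res_subgroup], of n] n by simp
  moreover have "\<one> \<in> Z" using characteristic_subgroup[OF Z] by (rule subgroup.one_closed)
  ultimately have "res \<subseteq> Z" using res_characteristic by blast
  then have "(\<lambda>x. x [^] N') ` res \<subseteq> C" using N'(2) by auto
  then have "generate G ((\<lambda>x. x [^] N') ` res) \<subseteq> C"
    by (rule generate_subgroup_incl[OF _ C_subgroup])
  then show ?thesis using res_generated_by_powers[OF N'(1)] by simp
qed

end

section \<open>Powers modulo a normal subgroup\<close>

context group
begin

lemma commutator_subgroup_consistent:
  assumes "subgroup H G" "U \<subseteq> H" "W \<subseteq> H"
  shows "commutator_subgroup (G\<lparr>carrier := H\<rparr>) U W = commutator_subgroup G U W"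
proof -
  have "(\<Union>a\<in>U. \<Union>b\<in>W. {a \<otimes> b \<otimes> inv\<^bsub>G\<lparr>carrier := H\<rparr>\<^esub> a \<otimes> inv\<^bsub>G\<lparr>carrier := H\<rparr>\<^esub> b})
     = (\<Union>a\<in>U. \<Union>b\<in>W. {a \<otimes> b \<otimes> inv a \<otimes> inv b})" (is "_ = ?S")
    using assms(2,3) by (intro SUP_cong refl) (simp add: subset_iff m_inv_consistent[OF assms(1)])
  moreover have "?S \<subseteq> H"
    using assms by (auto intro!: subgroup.m_closed[OF assms(1)] subgroup.m_inv_closed[OF assms(1)])
  ultimately show ?thesis unfolding commutator_subgroup_def using generate_consistent[OF _ assms(1)] by simp
qed

lemma pow_mult_mod:
  assumes N: "N \<lhd> G" and xy: "x \<in> carrier G" "y \<in> carrier G" "x \<otimes> y \<otimes> inv x \<otimes> inv y \<in> N"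
  shows "N #> (x \<otimes> y) [^] (n::nat) = N #> (x [^] n \<otimes> y [^] n)"
proof -
  interpret N: normal N G by fact
  interpret h: group_hom G "G Mod N" "\<lambda>a. N #> a" by (rule N.group_hom_Mod)
  have "(N #> x) \<otimes>\<^bsub>G Mod N\<^esub> (N #> y) = (N #> y) \<otimes>\<^bsub>G Mod N\<^esub> (N #> x)"
    using commutes_mod[OF N xy] xy by (metis h.hom_mult)
  then have "((N #> x) \<otimes>\<^bsub>G Mod N\<^esub> (N #> y)) [^]\<^bsub>G Mod N\<^esub> n
     = (N #> x) [^]\<^bsub>G Mod N\<^esub> n \<otimes>\<^bsub>G Mod N\<^esub> (N #> y) [^]\<^bsub>G Mod N\<^esub> n"
    using xy by (intro h.H.pow_mult_distrib) auto
  then show ?thesis using xy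
    by (simp only: h.hom_nat_pow[symmetric] h.hom_mult[symmetric] m_closed nat_pow_closed)
qed

lemma mult_mod_cong:
  assumes "N \<lhd> G" "x \<in> carrier G" "x' \<in> carrier G" "y \<in> carrier G" "y' \<in> carrier G"
    and "N #> x = N #> x'" "N #> y = N #> y'"
  shows "N #> (x \<otimes> y) = N #> (x' \<otimes> y')"
  using normal.rcos_sum[OF assms(1)] assms by metis

text \<open>As \<open>U\<close> is abelian modulo \<open>N\<close>, the \<open>n\<close>-th powers
  modulo \<open>N\<close> are closed under products. Hence divisibility of \<open>U\<close> modulo
  \<open>N\<close> can be checked on generators.\<close>

lemma subgroup_powers_mod:
  assumes N: "N \<lhd> G" and U: "subgroup U G"
    and comm: "\<And>x y. x \<in> U \<Longrightarrow> y \<in> U \<Longrightarrow> x \<otimes> y \<otimes> inv x \<otimes> inv y \<in> N"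
  shows "subgroup {z\<in>U. \<exists>w\<in>U. N #> z = N #> w [^] (n::nat)} G"
proof -
  interpret N: normal N G by fact
  interpret h: group_hom G "G Mod N" "\<lambda>a. N #> a" by (rule N.group_hom_Mod)
  have Uc: "x \<in> carrier G" if "x \<in> U" for x using subgroup.mem_carrier[OF U that] .
  show ?thesis
  proof (rule subgroupI)
    show "{z\<in>U. \<exists>w\<in>U. N #> z = N #> w [^] n} \<subseteq> carrier G" using Uc by auto
    have "\<one> \<in> {z\<in>U. \<exists>w\<in>U. N #> z = N #> w [^] n}"
      using subgroup.one_closed[OF U] by (auto intro!: bexI[of _ \<one>])
    then show "{z\<in>U. \<exists>w\<in>U. N #> z = N #> w [^] n} \<noteq> {}" by blast
  next
    fix z assume "z \<in> {z\<in>U. \<exists>w\<in>U. N #> z = N #> w [^] n}"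
    then obtain w where w: "z \<in> U" "w \<in> U" "N #> z = N #> w [^] n" by auto
    have "N #> inv z = inv\<^bsub>G Mod N\<^esub> (N #> w [^] n)" using h.hom_inv[OF Uc[OF w(1)]] w(3) by simp
    also have "\<dots> = N #> inv (w [^] n)" using h.hom_inv[of "w [^] n"] Uc[OF w(2)] by simp
    also have "\<dots> = N #> (inv w) [^] n" using Uc[OF w(2)] by (simp add: nat_pow_inv)
    finally show "inv z \<in> {z\<in>U. \<exists>w\<in>U. N #> z = N #> w [^] n}"
      using w subgroup.m_inv_closed[OF U] by blast
  next
    fix z z' assume "z \<in> {z\<in>U. \<exists>w\<in>U. N #> z = N #> w [^] n}" "z' \<in> {z\<in>U. \<exists>w\<in>U. N #> z = N #> w [^] n}"
    then obtain w w' where w: "z \<in> U" "w \<in> U" "N #> z = N #> w [^] n"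
      and w': "z' \<in> U" "w' \<in> U" "N #> z' = N #> w' [^] n" by auto
    have "N #> (z \<otimes> z') = N #> (w [^] n \<otimes> w' [^] n)"
      using w w' Uc by (intro mult_mod_cong[OF N]) auto
    also have "\<dots> = N #> (w \<otimes> w') [^] n"
      using w w' Uc comm by (intro pow_mult_mod[symmetric, OF N]) auto
    finally show "z \<otimes> z' \<in> {z\<in>U. \<exists>w\<in>U. N #> z = N #> w [^] n}"
      using w w' subgroup.m_closed[OF U] by blast
  qed
qed

end

section \<open>The lower central series of \<open>res\<close>\<close>

context soluble_rank_orbits
begin

text \<open>The lower central series of \<open>res\<close> is built inside \<open>G\<close>, so that
  its terms are visibly characteristic in \<open>G\<close>; \<open>lower_central_res\<close>
  translates to the group on \<open>res\<close> itself.\<close>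

primrec res_series where
  "res_series 0 = res"
| "res_series (Suc n) = commutator_subgroup G (res_series n) res"

lemma res_series_characteristic: "characteristic G (res_series n)"
  by (induction n) (auto simp: res_characteristic intro: characteristic_commutator_subgroup)

lemma res_series_subgroup: "subgroup (res_series n) G"
  using res_series_characteristic by (rule characteristic_subgroup)

lemma res_series_normal: "res_series n \<lhd> G"
  using res_series_characteristic by (rule characteristic_normal)

lemma res_series_carrier: "x \<in> res_series n \<Longrightarrow> x \<in> carrier G"
  using subgroup.mem_carrier[OF res_series_subgroup] .

lemma commutator_res_series: "a \<in> res_series n \<Longrightarrow> b \<in> res \<Longrightarrow> a \<otimes> b \<otimes> inv a \<otimes> inv b \<in> res_series (Suc n)"
  by (auto simp: commutator_subgroup_def intro: generate.incl)

lemma commutator_res_series': "a \<in> res_series n \<Longrightarrow> b \<in> res \<Longrightarrow> b \<otimes> a \<otimes> inv b \<otimes> inv a \<in> res_series (Suc n)"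
  using commutator_res_series inv_commutator[of a b] subgroup.m_inv_closed[OF res_series_subgroup] res_series_carrier res_carrier
  by metis

lemma res_series_Suc_subset: "res_series (Suc n) \<subseteq> res_series n"
proof -
  have "(\<Union>a\<in>res_series n. \<Union>b\<in>res. {a \<otimes> b \<otimes> inv a \<otimes> inv b}) \<subseteq> res_series n"
    using commutator_mem_normal[OF res_series_normal res_carrier] by auto
  then show ?thesis by (simp add: commutator_subgroup_def generate_subgroup_incl res_series_subgroup)
qed

lemma res_series_antimono: "i \<le> j \<Longrightarrow> res_series j \<subseteq> res_series i"
  using res_series_Suc_subset by (rule lift_Suc_antimono_le)

lemma res_series_subset_res: "res_series n \<subseteq> res"
  using res_series_antimono[of 0 n] by simp

lemma lower_central_res: "lower_central (G\<lparr>carrier := res\<rparr>) n = res_series n"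
  by (induction n) (simp_all add: commutator_subgroup_consistent[OF res_subgroup res_series_subset_res])

text \<open>As there are only finitely many characteristic subgroups, two terms are equal, and
  everything between them collapses.\<close>

lemma res_series_stationary: "\<exists>n. res_series (Suc n) = res_series n"
proof -
  have "finite (range res_series)"
    by (rule finite_subset[OF _ finite_characteristic_subgroups[OF orbits]]) (auto simp: res_series_characteristic)
  then have "\<not> inj res_series" using finite_imageD infinite_UNIV_nat by blast
  then obtain i j where "res_series i = res_series j" "i < j" unfolding inj_def by (metis nat_neq_iff)
  then have "res_series (Suc i) = res_series i"
    using res_series_antimono[of "Suc i" j] res_series_Suc_subset[of i] by auto
  then show ?thesis by blast
qed

text \<open>Here \<open>L\<close> is the stable term. Whichever case occurs, \<open>res\<close>
  centralizes \<open>L / M\<close>, so the next term, again \<open>L\<close>, would lie in the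
  proper subgroup \<open>M\<close>.\<close>

lemma res_series_trivial: "\<exists>n. res_series n = {\<one>}"
proof -
  obtain c where c: "res_series (Suc c) = res_series c" using res_series_stationary by blast
  define L where "L = res_series c"
  have L: "characteristic G L" unfolding L_def by (rule res_series_characteristic)
  have Ls: "subgroup L G" using L by (rule characteristic_subgroup)
  have "L = {\<one>}"
  proof (rule ccontr)
    assume nt: "L \<noteq> {\<one>}"
    have dL: "derived G L \<subseteq> L" by (rule derived_incl[OF subset_refl Ls])
    \<comment> \<open>A nontrivial subgroup of a soluble group is not perfect.\<close>
    have "derived G L \<noteq> L"
    proof
      assume d: "derived G L = L"
      have it: "(derived G ^^ n) L = L" for n by (induction n) (simp_all add: d)
      obtain n where n: "(derived G ^^ n) (carrier G) = {\<one>}"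
        using soluble solvable_iff_trivial_derived_seq by auto
      have "L \<subseteq> {\<one>}" using mono_exp_of_derived[OF subgroup.subset[OF Ls], of n] n it[of n] by simp
      then show False using nt subgroup.one_closed[OF Ls] by blast
    qed
    define S where "S = {H. characteristic G H \<and> derived G L \<subseteq> H \<and> H \<subset> L}"
    have "finite S"
      by (rule finite_subset[OF _ finite_characteristic_subgroups[OF orbits]]) (auto simp: S_def)
    moreover have "derived G L \<in> S"
      using dL \<open>derived G L \<noteq> L\<close> characteristic_derived[OF L] by (auto simp: S_def)
    ultimately obtain M where MS: "M \<in> S" and max: "\<And>H. H \<in> S \<Longrightarrow> M \<subseteq> H \<Longrightarrow> M = H"
      using finite_has_maximal[of S] by blast
    have M: "characteristic G M" "derived G L \<subseteq> M" "M \<subset> L" using MS by (auto simp: S_def)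
    have chief: "H = M \<or> H = L" if "characteristic G H" "M \<subseteq> H" "H \<subseteq> L" for H
      using max[of H] that M by (auto simp: S_def)
    have Ms: "subgroup M G" and Mn: "M \<lhd> G"
      using M(1) characteristic_subgroup characteristic_normal by auto
    have "res \<subseteq> section_centralizer G L M"
    proof (cases "\<exists>n::nat. 0 < n \<and> (\<forall>x\<in>L. x [^] n \<in> M)")
      case True
      then obtain n :: nat where "0 < n" "\<And>x. x \<in> L \<Longrightarrow> x [^] n \<in> M" by blast
      then have "finite ((\<lambda>x. M #> x) ` L)"
        by (rule finite_cosets_bounded_exponent[OF soluble rank _ Mn Ls])
      then show ?thesis by (rule res_centralizes_finite[OF L M(1)])
    next
      case False
      have comm: "x \<otimes> y \<otimes> inv x \<otimes> inv y \<in> M" if "x \<in> L" "y \<in> L" for x y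
      proof -
        have "x \<otimes> y \<otimes> inv x \<otimes> inv y \<in> derived G L"
          unfolding derived_def using that by (intro generate.incl) auto
        then show ?thesis using M(2) by auto
      qed
      have tf: "x \<in> M" if x: "x \<in> L" "0 < n" "x [^] n \<in> M" for x and n :: nat
      proof -
        \<comment> \<open>The elements whose \<open>n\<close>-th power lies in \<open>M\<close> form
          a characteristic subgroup between \<open>M\<close> and \<open>L\<close>. It is not
          \<open>L\<close>, because no exponent works for all of \<open>L\<close>, so it is
          \<open>M\<close>.\<close>
        define T where "T = {x\<in>L. x [^] n \<in> M}"
        have Lc: "x \<in> carrier G" if "x \<in> L" for x using subgroup.mem_carrier[OF Ls that] .
        have "characteristic G T"
        proof (rule characteristicI)
          show "subgroup T G"
          proof (rule subgroupI)
            show "T \<subseteq> carrier G" using Lc by (auto simp: T_def)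
            show "T \<noteq> {}" using x by (auto simp: T_def)
          next
            fix a assume "a \<in> T"
            then show "inv a \<in> T" using Lc subgroup.m_inv_closed[OF Ls] subgroup.m_inv_closed[OF Ms]
              by (auto simp: T_def nat_pow_inv)
          next
            fix a b assume ab: "a \<in> T" "b \<in> T"
            then have abL: "a \<in> L" "b \<in> L" "a [^] n \<in> M" "b [^] n \<in> M" by (auto simp: T_def)
            have "M #> (a \<otimes> b) [^] n = M #> (a [^] n \<otimes> b [^] n)"
              using abL Lc comm by (intro pow_mult_mod[OF Mn]) auto
            also have "\<dots> = M" using abL subgroup.m_closed[OF Ms] Lc by (intro coset_join2 Ms) auto
            finally have "(a \<otimes> b) [^] n \<in> M" using abL Lc by (intro coset_join1[OF _ _ Ms]) auto
            then show "a \<otimes> b \<in> T" using abL subgroup.m_closed[OF Ls] by (simp add: T_def)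
          qed
          fix \<gamma> a assume g: "\<gamma> \<in> auto G" and a: "a \<in> T"
          interpret h: group_hom G G \<gamma> using g by (rule auto_group_hom)
          have "\<gamma> a [^] n \<in> M"
            using a characteristicD[OF M(1) g, of "a [^] n"] h.hom_nat_pow[of a n] Lc by (auto simp: T_def)
          then show "\<gamma> a \<in> T" using a characteristicD[OF L g] by (auto simp: T_def)
        qed
        moreover have "M \<subseteq> T" using M(3) subgroup_nat_pow_closed[OF Ms] by (auto simp: T_def)
        moreover have "T \<subseteq> L" by (auto simp: T_def)
        moreover have "T \<noteq> L"
        proof
          assume "T = L"
          then have "\<forall>x\<in>L. x [^] n \<in> M" unfolding T_def by blast
          then show False using False x(2) by blast
        qed
        ultimately have "T = M" using chief by blast
        then show ?thesis using x by (auto simp: T_def)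
      qed
      interpret S: torsion_free_chief_section G r L M
        by unfold_locales (use L M chief tf in blast)+
      show ?thesis by (rule S.res_centralizes)
    qed
    then have "L \<subseteq> section_centralizer G res M"
      by (rule section_centralizer_swap[OF Ms subgroup.subset[OF Ls]])
    then have "(\<Union>a\<in>L. \<Union>b\<in>res. {a \<otimes> b \<otimes> inv a \<otimes> inv b}) \<subseteq> M"
      by (auto simp: section_centralizer_def)
    then have "res_series (Suc c) \<subseteq> M"
      unfolding L_def by (simp add: commutator_subgroup_def generate_subgroup_incl Ms)
    then show False using c M(3) L_def by blast
  qed
  then show ?thesis unfolding L_def by blast
qed

text \<open>The first factor is settled by \<open>res_generated_by_powers\<close>. Each further one
  is generated by commutators \<open>[a, b]\<close> with \<open>b\<close> in \<open>res\<close>; if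
  \<open>a\<close> is \<open>w^n\<close> modulo the next term, then \<open>[a, b]\<close> agrees
  with \<open>[w, b]^n\<close> one term further down.\<close>

lemma res_series_quotient_divisible:
  assumes "0 < (n::nat)"
  shows "z \<in> res_series i \<Longrightarrow> \<exists>w\<in>res_series i. res_series (Suc i) #> z = res_series (Suc i) #> w [^] n"
proof (induction i arbitrary: z)
  case 0
  let ?S = "{z\<in>res. \<exists>w\<in>res. res_series (Suc 0) #> z = res_series (Suc 0) #> w [^] n}"
  have "subgroup ?S G"
    using commutator_res_series[of _ 0] by (intro subgroup_powers_mod res_series_normal res_subgroup) auto
  moreover have "(\<lambda>x. x [^] n) ` res \<subseteq> ?S"
    using subgroup_nat_pow_closed[OF res_subgroup] by auto
  ultimately have "generate G ((\<lambda>x. x [^] n) ` res) \<subseteq> ?S" by (rule generate_subgroup_incl[rotated])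
  then show ?case using res_generated_by_powers[OF assms] 0 by auto
next
  case (Suc i)
  let ?N = "res_series (Suc (Suc i))" and ?U = "res_series (Suc i)"
  let ?S = "{z\<in>?U. \<exists>w\<in>?U. ?N #> z = ?N #> w [^] n}"
  have S: "subgroup ?S G"
    using commutator_res_series[of _ "Suc i"] res_series_subset_res[of "Suc i"]
    by (intro subgroup_powers_mod res_series_normal res_series_subgroup) blast
  have "a \<otimes> b \<otimes> inv a \<otimes> inv b \<in> ?S" if a: "a \<in> res_series i" and b: "b \<in> res" for a b
  proof -
    obtain w where w: "w \<in> res_series i" "?U #> a = ?U #> w [^] n" using Suc.IH[OF a] by blast
    define p where "p = w [^] n"
    define g where "g = a \<otimes> inv p"
    have c: "a \<in> carrier G" "b \<in> carrier G" "w \<in> carrier G" "p \<in> carrier G" "g \<in> carrier G"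
      using a b w res_series_carrier res_carrier by (auto simp: p_def g_def)
    have g: "g \<in> ?U" using w(2) c rcos_eq_iff[OF res_series_subgroup] by (simp add: p_def g_def del: res_series.simps)
    have wr: "w \<in> res" using w(1) res_series_subset_res by blast
    \<comment> \<open>Write \<open>a = g p\<close> with \<open>g\<close> in \<open>?U\<close>.
      Modulo \<open>?N\<close> the factor \<open>g\<close> commutes with all of \<open>res\<close>,
      so it cancels from the commutator and \<open>[a, b]\<close> agrees with
      \<open>[p, b]\<close>.\<close>
    let ?q = "p \<otimes> b \<otimes> inv p"
    have qr: "?q \<in> res" using b c normal.inv_op_closed2[OF res_normal] by simp
    have ag: "a = g \<otimes> p" using c by (simp add: g_def m_assoc)
    have gq: "?N #> (g \<otimes> ?q) = ?N #> (?q \<otimes> g)"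
      using c by (intro commutes_mod res_series_normal commutator_res_series g qr) auto
    have "?N #> (g \<otimes> ?q \<otimes> (inv g \<otimes> inv b)) = ?N #> (?q \<otimes> g \<otimes> (inv g \<otimes> inv b))"
      by (rule mult_mod_cong[OF res_series_normal _ _ _ _ gq refl]) (use c in auto)
    moreover have "g \<otimes> ?q \<otimes> (inv g \<otimes> inv b) = a \<otimes> b \<otimes> inv a \<otimes> inv b"
      using c by (simp add: ag m_assoc inv_mult_group)
    moreover have "?q \<otimes> g \<otimes> (inv g \<otimes> inv b) = p \<otimes> b \<otimes> inv p \<otimes> inv b"
      using c by (simp add: m_assoc group_cancel)
    ultimately have 1: "?N #> (a \<otimes> b \<otimes> inv a \<otimes> inv b) = ?N #> (p \<otimes> b \<otimes> inv p \<otimes> inv b)" by simp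
    define z where "z = w \<otimes> b \<otimes> inv w \<otimes> inv b"
    have z: "z \<in> ?U" unfolding z_def by (rule commutator_res_series[OF w(1) b])
    have "w \<otimes> z \<otimes> inv w \<otimes> inv z \<in> ?N" by (rule commutator_res_series'[OF z wr])
    then have "?N #> (p \<otimes> b \<otimes> inv p \<otimes> inv b) = ?N #> z [^] n"
      unfolding p_def by (rule commutator_pow_mod[OF res_series_normal c(3,2) z_def])
    then show ?thesis using 1 z commutator_res_series[OF a b] by auto
  qed
  then have "(\<Union>a\<in>res_series i. \<Union>b\<in>res. {a \<otimes> b \<otimes> inv a \<otimes> inv b}) \<subseteq> ?S" by blast
  then have "?U \<subseteq> ?S"
    using generate_subgroup_incl[OF _ S] by (simp add: commutator_subgroup_def)
  then show ?case using Suc.prems by auto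
qed

section \<open>Roots and torsion in \<open>res\<close>\<close>

text \<open>Successive correction: the error \<open>g\<close> of a root modulo one term has an
  \<open>n\<close>-th root \<open>w\<close> modulo the next, where \<open>w\<close> commutes with
  \<open>y\<close>, so \<open>w \<otimes> y\<close> is the improved root.\<close>

lemma res_root_mod_res_series:
  assumes "0 < (n::nat)" "x \<in> res"
  shows "\<exists>y\<in>res. res_series i #> x = res_series i #> y [^] n"
proof (induction i)
  case 0
  have "res_series 0 #> x = res_series 0 #> \<one> [^] n"
    using assms(2) res_carrier by (subst rcos_eq_iff[OF res_series_subgroup]) auto
  then show ?case using subgroup.one_closed[OF res_subgroup] by blast
next
  case (Suc i)
  let ?N = "res_series (Suc i)"
  obtain y where y: "y \<in> res" "res_series i #> x = res_series i #> y [^] n" using Suc by blast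
  define g where "g = x \<otimes> inv (y [^] n)"
  have xy: "x \<in> carrier G" "y \<in> carrier G" using assms(2) y(1) res_carrier by auto
  have "g \<in> res_series i" using y(2) xy rcos_eq_iff[OF res_series_subgroup] by (simp add: g_def)
  then obtain w where w: "w \<in> res_series i" "?N #> g = ?N #> w [^] n"
    using res_series_quotient_divisible[OF assms(1)] by blast
  have wc: "w \<in> carrier G" "g \<in> carrier G" using w(1) res_series_carrier xy by (auto simp: g_def)
  have "?N #> (g \<otimes> y [^] n) = ?N #> (w [^] n \<otimes> y [^] n)"
    using w(2) wc xy by (intro mult_mod_cong res_series_normal) auto
  also have "\<dots> = ?N #> (w \<otimes> y) [^] n"
    using wc xy by (intro pow_mult_mod[symmetric] res_series_normal commutator_res_series w y) auto
  also have "g \<otimes> y [^] n = x" using xy by (simp add: g_def m_assoc)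
  finally show ?case
    using w(1) y(1) res_series_subset_res[of i] subgroup.m_closed[OF res_subgroup] by blast
qed

lemma res_root:
  assumes "0 < (n::nat)" "x \<in> res"
  shows "\<exists>y\<in>res. y [^] n = x"
proof -
  obtain i where i: "res_series i = {\<one>}" using res_series_trivial by blast
  obtain y where y: "y \<in> res" "{\<one>} #> x = {\<one>} #> y [^] n"
    using res_root_mod_res_series[OF assms, of i] i by auto
  then have "x = y [^] n" using assms(2) res_carrier by (auto simp: r_coset_def)
  then show ?thesis using y by auto
qed

text \<open>Orders modulo \<open>N\<close> are constant along orbits, so some \<open>e > 0\<close> kills all torsion modulo
  \<open>N\<close>; an \<open>e\<close>-th root of a torsion element is again torsion.\<close>

lemma res_torsion_free_mod:
  assumes N: "characteristic G N" and t: "t \<in> res" "0 < (n::nat)" "t [^] n \<in> N"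
  shows "t \<in> N"
proof -
  have Ns: "subgroup N G" using N by (rule characteristic_subgroup)
  obtain F where F: "finite F" "F \<subseteq> carrier G" "\<forall>x\<in>carrier G. \<exists>\<gamma>\<in>auto G. \<exists>y\<in>F. \<gamma> y = x"
    using finite_orbit_representatives[OF orbits] by blast
  define F' where "F' = {y\<in>F. \<exists>k::nat. 0 < k \<and> y [^] k \<in> N}"
  have "\<forall>y\<in>F'. \<exists>k::nat. 0 < k \<and> y [^] k \<in> N" by (auto simp: F'_def)
  then obtain k :: "'a \<Rightarrow> nat" where k: "\<And>y. y \<in> F' \<Longrightarrow> 0 < k y \<and> y [^] k y \<in> N" by metis
  have fF: "finite F'" using F(1) by (simp add: F'_def)
  define e where "e = prod k F'"
  have "0 < e" unfolding e_def using k by (intro prod_pos) auto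
  then obtain s where s: "s \<in> res" "s [^] e = t" using res_root t(1) by blast
  have sc: "s \<in> carrier G" using s res_carrier by auto
  obtain \<gamma> y where g: "\<gamma> \<in> auto G" "y \<in> F" "\<gamma> y = s" using F(3) sc by blast
  have yc: "y \<in> carrier G" using g F by auto
  interpret h: group_hom G G \<gamma> using g(1) by (rule auto_group_hom)
  obtain \<delta> where d: "\<delta> \<in> auto G" "\<forall>x\<in>carrier G. \<delta> (\<gamma> x) = x \<and> \<gamma> (\<delta> x) = x"
    using auto_inverse[OF g(1)] by blast
  have "s [^] (e * n) \<in> N" using t(3) s(2) nat_pow_pow[OF sc] by metis
  then have "\<gamma> (y [^] (e * n)) \<in> N" using h.hom_nat_pow[OF yc] g(3) by simp
  then have "\<delta> (\<gamma> (y [^] (e * n))) \<in> N" by (rule characteristicD[OF N d(1)])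
  then have "y [^] (e * n) \<in> N" using d(2) yc by simp
  moreover have "0 < e * n" using \<open>0 < e\<close> t(2) by simp
  ultimately have y: "y \<in> F'" using g(2) unfolding F'_def by blast
  have "e = k y * prod k (F' - {y})" unfolding e_def using fF y by (simp add: prod.remove)
  then have "y [^] e \<in> N"
    using k[OF y] nat_pow_pow[OF yc] subgroup_nat_pow_closed[OF Ns] by metis
  then have "\<gamma> (y [^] e) \<in> N" by (rule characteristicD[OF N g(1)])
  then show ?thesis using h.hom_nat_pow[OF yc] g(3) s(2) by simp
qed

end

section \<open>The complement\<close>

lemma (in comm_group) finprod_endo:
  assumes "\<phi> \<in> hom G G" "f \<in> Q \<rightarrow> carrier G"
  shows "\<phi> (\<Otimes>q\<in>Q. f q) = (\<Otimes>q\<in>Q. \<phi> (f q))"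
  using assms(2)
proof (induction Q rule: infinite_finite_induct)
  case (insert q Q)
  then have "f \<in> Q \<rightarrow> carrier G" "f q \<in> carrier G" by auto
  with insert assms(1) show ?case by (simp add: endo_mult endo_closed Pi_iff)
qed (use endo_one[OF assms(1)] in auto)

text \<open>For a transversal \<open>s\<close> of \<open>A\<close> the product of the \<open>h s(C) s(hC)\<^sup>-\<^sup>1\<close> over all cosets \<open>C\<close>
  is a crossed homomorphism \<open>d\<close> into \<open>A\<close> with \<open>d(a) = a\<^sup>n\<close> on \<open>A\<close>; its kernel is a complement.\<close>

lemma (in group) exists_abelian_complement:
  assumes A: "A \<lhd> G" and comm: "\<And>a b. a \<in> A \<Longrightarrow> b \<in> A \<Longrightarrow> a \<otimes> b = b \<otimes> a"
    and fin: "finite (rcosets A)"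
    and inj: "\<And>a. a \<in> A \<Longrightarrow> a [^] card (rcosets A) = \<one> \<Longrightarrow> a = \<one>"
    and surj: "\<And>a. a \<in> A \<Longrightarrow> \<exists>b\<in>A. b [^] card (rcosets A) = a"
  shows "\<exists>K. subgroup K G \<and> A \<inter> K = {\<one>} \<and> carrier G = A <#> K"
proof -
  interpret A: normal A G by fact
  interpret Q: group "G Mod A" by (rule A.factorgroup_is_group)
  interpret q: group_hom G "G Mod A" "\<lambda>x. A #> x" by (rule A.group_hom_Mod)
  let ?A = "G\<lparr>carrier := A\<rparr>" and ?n = "card (rcosets A)"
  interpret A': comm_group ?A
    by (rule group.group_comm_groupI[OF A.subgroup_is_group[OF is_group]]) (use comm in simp)
  have carr: "carrier (G Mod A) = rcosets A" by (simp add: FactGroup_def)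
  define s where "s C = (SOME c. c \<in> C)" for C :: "'a set"
  have s: "s C \<in> carrier G" "A #> s C = C" if C: "C \<in> rcosets A" for C
  proof -
    obtain x where x: "x \<in> carrier G" "C = A #> x" using C by (auto simp: RCOSETS_def)
    have "x \<in> C" using x rcos_self[OF _ A.subgroup_axioms] by simp
    then have sC: "s C \<in> C" unfolding s_def by (rule someI)
    then show "s C \<in> carrier G" using x A.elemrcos_carrier[OF is_group] by auto
    show "A #> s C = C" using repr_independence[of "s C" A x] sC x A.subgroup_axioms by simp
  qed
  define act where "act h C = (A #> h) \<otimes>\<^bsub>G Mod A\<^esub> C" for h C
  have act_closed: "act h C \<in> rcosets A" if "h \<in> carrier G" "C \<in> rcosets A" for h C
    using that Q.m_closed[of "A #> h" C] q.hom_closed carr unfolding act_def by auto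
  have act_coset: "A #> (h \<otimes> s C) = act h C" if "h \<in> carrier G" "C \<in> rcosets A" for h C
    using q.hom_mult[OF that(1) s(1)[OF that(2)]] s(2)[OF that(2)] by (simp add: act_def)
  have act_mult: "act (h \<otimes> k) C = act h (act k C)"
    if "h \<in> carrier G" "k \<in> carrier G" "C \<in> rcosets A" for h k C
    using that q.hom_mult[of h k] Q.m_assoc[of "A #> h" "A #> k" C] q.hom_closed carr
    unfolding act_def by auto
  have act_bij: "inj_on (act k) (rcosets A)" "act k ` (rcosets A) = rcosets A" if "k \<in> carrier G" for k
    using Q.inj_on_cmult[OF q.hom_closed[OF that]] Q.surj_const_mult[OF q.hom_closed[OF that]]
    unfolding act_def carr by auto
  define e where "e h C = h \<otimes> s C \<otimes> inv (s (act h C))" for h C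
  have eA: "e h C \<in> A" if "h \<in> carrier G" "C \<in> rcosets A" for h C
    using that act_coset[OF that] s[OF that(2)] s[OF act_closed[OF that]]
      rcos_eq_iff[OF A.subgroup_axioms, of "h \<otimes> s C" "s (act h C)"] by (simp add: e_def)
  define d where "d h = finprod ?A (e h) (rcosets A)" for h
  have dA: "d h \<in> A" if "h \<in> carrier G" for h
    using A'.finprod_closed[of "e h" "rcosets A"] eA[OF that] by (auto simp: d_def)
  have conj: "(\<lambda>a. h \<otimes> a \<otimes> inv h) \<in> hom ?A ?A" if h: "h \<in> carrier G" for h
    using A.inv_op_closed2[OF h] h by (auto simp: hom_def m_assoc group_cancel)
  \<comment> \<open>Multiply \<open>e (h k) C = (h (e k C) h^-1) (e h (act k C))\<close> over all
    cosets; the second product can be reindexed because \<open>act k\<close> permutes the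
    cosets.\<close>
  have d_mult: "d (h \<otimes> k) = (h \<otimes> d k \<otimes> inv h) \<otimes> d h"
    if h: "h \<in> carrier G" and k: "k \<in> carrier G" for h k
  proof -
    have c: "(\<lambda>C. h \<otimes> e k C \<otimes> inv h) \<in> rcosets A \<rightarrow> carrier ?A"
      "(\<lambda>C. e h (act k C)) \<in> rcosets A \<rightarrow> carrier ?A" "e k \<in> rcosets A \<rightarrow> carrier ?A"
      "e h \<in> act k ` (rcosets A) \<rightarrow> carrier ?A"
      using eA[OF k] eA[OF h] act_closed[OF k] A.inv_op_closed2[OF h] by auto
    have "d (h \<otimes> k) = finprod ?A (\<lambda>C. (h \<otimes> e k C \<otimes> inv h) \<otimes>\<^bsub>?A\<^esub> e h (act k C)) (rcosets A)"
      unfolding d_def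
    proof (rule A'.finprod_cong')
      fix C assume C: "C \<in> rcosets A"
      note sc = s(1)[OF C] s(1)[OF act_closed[OF k C]] s(1)[OF act_closed[OF h act_closed[OF k C]]]
      show "e (h \<otimes> k) C = (h \<otimes> e k C \<otimes> inv h) \<otimes>\<^bsub>?A\<^esub> e h (act k C)"
        using sc h k by (simp add: e_def act_mult[OF h k C] m_assoc group_cancel)
    qed (use c A.m_closed in auto)
    also have "\<dots> = finprod ?A (\<lambda>C. h \<otimes> e k C \<otimes> inv h) (rcosets A)
        \<otimes>\<^bsub>?A\<^esub> finprod ?A (\<lambda>C. e h (act k C)) (rcosets A)"
      by (rule A'.finprod_multf[OF c(1,2)])
    also have "finprod ?A (\<lambda>C. h \<otimes> e k C \<otimes> inv h) (rcosets A) = h \<otimes> d k \<otimes> inv h"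
      unfolding d_def by (rule A'.finprod_endo[OF conj[OF h] c(3), symmetric])
    also have "finprod ?A (\<lambda>C. e h (act k C)) (rcosets A) = d h"
      using A'.finprod_reindex[OF c(4) act_bij(1)[OF k]] act_bij(2)[OF k] by (simp add: d_def)
    finally show ?thesis by simp
  qed
  have d_A: "d a = a [^] ?n" if a: "a \<in> A" for a
  proof -
    have ac: "a \<in> carrier G" using a by simp
    have "A #> a = \<one>\<^bsub>G Mod A\<^esub>" using A.rcos_const[OF is_group a] by simp
    then have "act a C = C" if "C \<in> rcosets A" for C
      using Q.l_one[of C] that carr by (simp only: act_def)
    then have "d a = finprod ?A (\<lambda>_. a) (rcosets A)"
      unfolding d_def using a ac s by (intro A'.finprod_cong') (auto simp: e_def m_assoc)
    also have "\<dots> = a [^]\<^bsub>?A\<^esub> ?n" using a by (intro A'.finprod_const) simp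
    finally show ?thesis using nat_pow_consistent by metis
  qed
  define K where "K = {h\<in>carrier G. d h = \<one>}"
  have d1: "d \<one> = \<one>" using d_A[of \<one>] by simp
  have "subgroup K G"
  proof (rule subgroupI)
    show "K \<subseteq> carrier G" "K \<noteq> {}" using d1 by (auto simp: K_def)
  next
    fix h assume "h \<in> K"
    then have h: "h \<in> carrier G" "d h = \<one>" by (auto simp: K_def)
    have "d (inv h \<otimes> h) = (inv h \<otimes> d h \<otimes> inv (inv h)) \<otimes> d (inv h)" using h by (intro d_mult) auto
    then have "d (inv h) = \<one>" using h d1 dA[of "inv h"] by simp
    then show "inv h \<in> K" using h by (simp add: K_def)
  next
    fix h k assume "h \<in> K" "k \<in> K"
    then show "h \<otimes> k \<in> K" by (auto simp: K_def d_mult)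
  qed
  moreover have "A \<inter> K = {\<one>}"
    using inj d_A d1 by (auto simp: K_def)
  moreover have "carrier G = A <#> K"
  proof
    show "A <#> K \<subseteq> carrier G" by (auto simp: set_mult_def K_def)
    show "carrier G \<subseteq> A <#> K"
    proof
      fix g assume g: "g \<in> carrier G"
      \<comment> \<open>As \<open>d (a g)\<close> is \<open>d g\<close> times \<open>a^n\<close>, an
        \<open>n\<close>-th root \<open>a\<close> of the inverse of \<open>d g\<close> moves
        \<open>g\<close> into the kernel \<open>K\<close>.\<close>
      obtain a where a: "a \<in> A" "a [^] ?n = inv (d g)" using surj[of "inv (d g)"] dA[OF g] by auto
      have ac: "a \<in> carrier G" "d g \<in> carrier G" using a dA[OF g] by auto
      have "d (a \<otimes> g) = (a \<otimes> d g \<otimes> inv a) \<otimes> inv (d g)" using d_mult[OF ac(1) g] d_A[OF a(1)] a(2) by simp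
      also have "a \<otimes> d g \<otimes> inv a = d g" using comm[OF a(1) dA[OF g]] ac by (simp add: m_assoc)
      finally have "a \<otimes> g \<in> K" using ac g by (simp add: K_def)
      moreover have "g = inv a \<otimes> (a \<otimes> g)" using ac g by (simp add: group_cancel)
      ultimately show "g \<in> A <#> K" using A.m_inv_closed[OF a(1)] unfolding set_mult_def by blast
    qed
  qed
  ultimately show ?thesis by blast
qed

section \<open>Supplements of \<open>res\<close> with shrinking intersection\<close>

context soluble_rank_orbits
begin

text \<open>In \<open>?Q\<close> the image \<open>?A\<close> of \<open>res_series i\<close> is
  abelian, normal and of finite index, and uniquely divisible by that index. The preimage in
  \<open>H\<close> of a complement of \<open>?A\<close> is the new supplement.\<close>

lemma supplement_step:
  assumes H: "subgroup H G" "res \<inter> H = res_series i" "carrier G = res <#> H"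
  shows "\<exists>H'. subgroup H' G \<and> res \<inter> H' = res_series (Suc i) \<and> carrier G = res <#> H'"
proof -
  let ?N = "res_series (Suc i)" and ?H = "G\<lparr>carrier := H\<rparr>"
  let ?Q = "?H Mod ?N"
  have giH: "res_series i \<subseteq> H" using H(2) by auto
  have NH: "?N \<subseteq> H" using res_series_Suc_subset giH by blast
  have Hc: "h \<in> carrier G" if "h \<in> H" for h using subgroup.mem_carrier[OF H(1) that] .
  interpret N: normal ?N ?H by (rule normal_restrict_supergroup[OF H(1) res_series_normal NH])
  interpret Q: group ?Q by (rule N.factorgroup_is_group)
  interpret q: group_hom ?H ?Q "\<lambda>x. ?N #> x" using N.group_hom_Mod by simp
  let ?A = "(\<lambda>x. ?N #> x) ` res_series i"
  have qm: "(?N #> a) \<otimes>\<^bsub>?Q\<^esub> (?N #> b) = ?N #> (a \<otimes> b)" if "a \<in> H" "b \<in> H" for a b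
    using q.hom_mult[of a b] that by simp
  have qi: "inv\<^bsub>?Q\<^esub> (?N #> a) = ?N #> inv a" if "a \<in> H" for a
    using q.hom_inv[of a] that m_inv_consistent[OF H(1) that] by simp
  have qp: "(?N #> a) [^]\<^bsub>?Q\<^esub> (n::nat) = ?N #> a [^] n" if "a \<in> H" for a n
    using q.hom_nat_pow[of a n] that nat_pow_consistent[of a n H] by simp
  have q1: "?N #> a = \<one>\<^bsub>?Q\<^esub> \<longleftrightarrow> a \<in> ?N" if "a \<in> H" for a
    using coset_join1[OF _ Hc[OF that] res_series_subgroup] coset_join2[OF Hc[OF that] res_series_subgroup]
    by (auto simp del: res_series.simps)
  have "res_series i \<lhd> ?H" by (rule normal_restrict_supergroup[OF H(1) res_series_normal giH])
  then interpret B: normal "res_series i" ?H .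
  have A: "?A \<lhd> ?Q"
    by (rule B.surj_hom_normal_subgroup[OF q.group_hom_axioms]) (simp add: carrier_FactGroup)
  \<comment> \<open>Since \<open>res \<inter> H = res_series i\<close>, the quotient of
    \<open>H\<close> by \<open>res_series i\<close> embeds in that of \<open>G\<close> by
    \<open>res\<close>; sending \<open>c\<close> to \<open>res <#> c\<close> realises this on cosets
    of \<open>?N\<close>.\<close>
  have "finite (rcosets\<^bsub>?Q\<^esub> ?A)"
  proof -
    have "finite ((\<lambda>c. ?A #>\<^bsub>?Q\<^esub> c) ` carrier ?Q)"
    proof (rule Q.finite_cosets_if_finite_image)
      show "subgroup ?A ?Q" using A by (rule normal_imp_subgroup)
      have f: "res <#> (?N #> h) = res #> h" if "h \<in> H" for h
        using setmult_rcos_assoc[of res ?N h] Hc[OF that] res_carrier res_series_carrier[of _ "Suc i"]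
          set_mult_subgroup_idem[OF res_subgroup, of ?N] subgroup_incl[OF res_series_subgroup res_subgroup res_series_subset_res]
        by (auto simp del: res_series.simps)
      have "(\<lambda>c. res <#> c) ` carrier ?Q \<subseteq> (\<lambda>x. res #> x) ` carrier G"
        using f Hc by (auto simp: carrier_FactGroup simp del: res_series.simps)
      then show "finite ((\<lambda>c. res <#> c) ` carrier ?Q)"
        using res_characteristic_finite by (meson finite_subset)
      fix c c' assume "c \<in> carrier ?Q" "c' \<in> carrier ?Q" and eq: "res <#> c = res <#> c'"
      then obtain h h' where h: "h \<in> H" "h' \<in> H" "c = ?N #> h" "c' = ?N #> h'"
        by (auto simp: carrier_FactGroup simp del: res_series.simps)
      have "h \<otimes> inv h' \<in> res" using eq h f Hc rcos_eq_iff[OF res_subgroup, of h h'] by metis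
      moreover have "h \<otimes> inv h' \<in> H" using h H(1) by (simp add: subgroup.m_closed subgroup.m_inv_closed)
      ultimately have "h \<otimes> inv h' \<in> res_series i" using H(2) by blast
      then have "?N #> (h \<otimes> inv h') \<in> ?A" by blast
      then show "c \<otimes>\<^bsub>?Q\<^esub> inv\<^bsub>?Q\<^esub> c' \<in> ?A"
        using h qi qm[of h "inv h'"] subgroup.m_inv_closed[OF H(1)] by metis
    qed simp
    then show ?thesis by (simp add: RCOSETS_def UNION_singleton_eq_range)
  qed
  moreover have "rcosets\<^bsub>?Q\<^esub> ?A \<noteq> {}" using Q.one_closed unfolding RCOSETS_def by blast
  ultimately have fin: "finite (rcosets\<^bsub>?Q\<^esub> ?A)" and pos: "0 < card (rcosets\<^bsub>?Q\<^esub> ?A)"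
    by (auto simp: card_gt_0_iff)
  have "\<exists>K. subgroup K ?Q \<and> ?A \<inter> K = {\<one>\<^bsub>?Q\<^esub>} \<and> carrier ?Q = ?A <#>\<^bsub>?Q\<^esub> K"
  proof (rule Q.exists_abelian_complement[OF A _ fin])
    fix u v assume "u \<in> ?A" "v \<in> ?A"
    then obtain a b where ab: "a \<in> res_series i" "b \<in> res_series i" "u = ?N #> a" "v = ?N #> b" by blast
    have "?N #> (a \<otimes> b) = ?N #> (b \<otimes> a)"
      using ab res_series_carrier res_series_subset_res[of i] by (intro commutes_mod res_series_normal commutator_res_series) auto
    then show "u \<otimes>\<^bsub>?Q\<^esub> v = v \<otimes>\<^bsub>?Q\<^esub> u" using ab giH qm by (metis subsetD)
  next
    fix u assume "u \<in> ?A" and one: "u [^]\<^bsub>?Q\<^esub> card (rcosets\<^bsub>?Q\<^esub> ?A) = \<one>\<^bsub>?Q\<^esub>"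
    then obtain a where a: "a \<in> res_series i" "u = ?N #> a" by blast
    have aH: "a \<in> H" "a \<in> res" using a giH res_series_subset_res by blast+
    \<comment> \<open>Injectivity of the power map on \<open>?A\<close> is torsion-freeness of
      \<open>res\<close> modulo \<open>?N\<close>.\<close>
    have "a [^] card (rcosets\<^bsub>?Q\<^esub> ?A) \<in> ?N"
      using one a(2) qp[OF aH(1)] q1 subgroup_nat_pow_closed[OF H(1) aH(1)] by metis
    then have "a \<in> ?N" by (rule res_torsion_free_mod[OF res_series_characteristic aH(2) pos])
    then show "u = \<one>\<^bsub>?Q\<^esub>" using q1[OF aH(1)] a(2) by blast
  next
    fix u assume "u \<in> ?A"
    then obtain a where a: "a \<in> res_series i" "u = ?N #> a" by blast
    obtain y where y: "y \<in> res" "y [^] card (rcosets\<^bsub>?Q\<^esub> ?A) = a"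
      using res_root[OF pos] a res_series_subset_res by blast
    \<comment> \<open>The root found in \<open>res\<close> already lies in
      \<open>res_series i\<close>, because \<open>res\<close> is torsion-free modulo that
      term.\<close>
    have "y \<in> res_series i" using a(1) y(2) by (intro res_torsion_free_mod[OF res_series_characteristic y(1) pos]) simp
    then show "\<exists>b\<in>?A. b [^]\<^bsub>?Q\<^esub> card (rcosets\<^bsub>?Q\<^esub> ?A) = u"
      using qp giH y(2) a(2) by (intro bexI[of _ "?N #> y"]) auto
  qed
  then obtain K where K: "subgroup K ?Q" "?A \<inter> K = {\<one>\<^bsub>?Q\<^esub>}" "carrier ?Q = ?A <#>\<^bsub>?Q\<^esub> K" by blast
  define H' where "H' = {h\<in>H. ?N #> h \<in> K}"
  have NH': "?N \<subseteq> H'"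
  proof
    fix a assume a: "a \<in> ?N"
    then have "a \<in> H" using NH by blast
    moreover have "?N #> a = \<one>\<^bsub>?Q\<^esub>" using q1[OF \<open>a \<in> H\<close>] a by blast
    ultimately show "a \<in> H'" using subgroup.one_closed[OF K(1)] by (simp add: H'_def)
  qed
  have H': "subgroup H' G"
  proof (rule subgroupI)
    show "H' \<subseteq> carrier G" using Hc by (auto simp: H'_def)
    show "H' \<noteq> {}" using NH' subgroup.one_closed[OF res_series_subgroup] by blast
  next
    fix h assume "h \<in> H'"
    then show "inv h \<in> H'" using qi subgroup.m_inv_closed[OF K(1)] subgroup.m_inv_closed[OF H(1)]
      unfolding H'_def by fastforce
  next
    fix h k assume "h \<in> H'" "k \<in> H'"
    then show "h \<otimes> k \<in> H'" using qm subgroup.m_closed[OF K(1)] subgroup.m_closed[OF H(1)]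
      unfolding H'_def by fastforce
  qed
  have "res \<inter> H' = ?N"
  proof
    show "?N \<subseteq> res \<inter> H'" using NH' res_series_subset_res by blast
    show "res \<inter> H' \<subseteq> ?N"
    proof
      fix h assume h: "h \<in> res \<inter> H'"
      then have "h \<in> res_series i" "h \<in> H" using H(2) by (auto simp: H'_def)
      then have "?N #> h \<in> ?A \<inter> K" using h unfolding H'_def by blast
      then have "?N #> h = \<one>\<^bsub>?Q\<^esub>" unfolding K(2) by (rule singletonD)
      then show "h \<in> ?N" using q1[OF \<open>h \<in> H\<close>] by (simp only:)
    qed
  qed
  moreover have "carrier G \<subseteq> res <#> H'"
  proof
    fix g assume "g \<in> carrier G"
    then obtain x h where x: "x \<in> res" "h \<in> H" "g = x \<otimes> h" using H(3) unfolding set_mult_def by blast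
    have "?N #> h \<in> ?A <#>\<^bsub>?Q\<^esub> K" using K(3) x(2) by (auto simp: carrier_FactGroup)
    then obtain a u where a: "a \<in> res_series i" "u \<in> K" "?N #> h = (?N #> a) \<otimes>\<^bsub>?Q\<^esub> u"
      unfolding set_mult_def[of ?Q] by blast
    obtain k where k: "k \<in> H" "u = ?N #> k"
      using subgroup.mem_carrier[OF K(1) a(2)] by (auto simp: carrier_FactGroup)
    have kH': "k \<in> H'" using k a(2) by (simp add: H'_def)
    have aH: "a \<in> H" "a \<in> res" using a giH res_series_subset_res by blast+
    have "?N #> h = ?N #> (a \<otimes> k)" using a(3) k qm[OF aH(1) k(1)] by simp
    then have "h \<otimes> inv (a \<otimes> k) \<in> ?N"
      using rcos_eq_iff[OF res_series_subgroup] Hc x(2) aH(1) k(1) by (simp del: res_series.simps)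
    then have n: "h \<otimes> inv (a \<otimes> k) \<in> res" using res_series_subset_res by blast
    \<comment> \<open>Modulo \<open>?N\<close> the element \<open>h\<close> is
      \<open>a \<otimes> k\<close>; the discrepancy and \<open>a\<close> both lie in
      \<open>res\<close> and are absorbed into the left factor, leaving \<open>k\<close> in
      \<open>H'\<close>.\<close>
    have "x \<otimes> (h \<otimes> inv (a \<otimes> k)) \<otimes> a \<in> res"
      using n x(1) aH(2) res_subgroup by (simp add: subgroup.m_closed)
    moreover have "g = (x \<otimes> (h \<otimes> inv (a \<otimes> k)) \<otimes> a) \<otimes> k"
      using x res_carrier Hc aH k(1) by (simp add: m_assoc inv_mult_group group_cancel)
    ultimately show "g \<in> res <#> H'" using kH' unfolding set_mult_def by blast
  qed
  moreover have "res <#> H' \<subseteq> carrier G"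
    using res_carrier subgroup.mem_carrier[OF H'] by (auto simp: set_mult_def)
  ultimately show ?thesis using H' by blast
qed

text \<open>The descent starts with \<open>H\<close> the whole group, which meets \<open>res\<close>
  in \<open>res_series 0\<close>.\<close>

lemma supplement: "\<exists>H. subgroup H G \<and> res \<inter> H = res_series i \<and> carrier G = res <#> H"
proof (induction i)
  case 0
  have "res <#> carrier G = carrier G"
    using res_carrier subgroup.one_closed[OF res_subgroup] by (force simp: set_mult_def)
  then show ?case
    using subgroup_self subgroup.subset[OF res_subgroup] by (intro exI[of _ "carrier G"]) auto
qed (use supplement_step in blast)

text \<open>At the trivial term of the series the supplement is a complement; it embeds in the set
  of cosets of \<open>res\<close>, hence is finite.\<close>

lemma complement: "\<exists>H. subgroup H G \<and> res \<inter> H = {\<one>} \<and> carrier G = res <#> H \<and> finite H"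
proof -
  obtain i where i: "res_series i = {\<one>}" using res_series_trivial by blast
  obtain H where H: "subgroup H G" "res \<inter> H = {\<one>}" "carrier G = res <#> H"
    using supplement[of i] unfolding i by blast
  have "inj_on (\<lambda>x. res #> x) H"
  proof (rule inj_onI)
    fix x y assume xy: "x \<in> H" "y \<in> H" "res #> x = res #> y"
    have c: "x \<in> carrier G" "y \<in> carrier G" using xy subgroup.mem_carrier[OF H(1)] by auto
    have "x \<otimes> inv y \<in> res \<inter> H"
      using xy c rcos_eq_iff[OF res_subgroup] H(1) by (simp add: subgroup.m_closed subgroup.m_inv_closed)
    then have "x \<otimes> inv y = \<one>" using H(2) by blast
    then show "x = y" using c by (simp add: inv_solve_right')
  qed
  moreover have "(\<lambda>x. res #> x) ` H \<subseteq> (\<lambda>x. res #> x) ` carrier G"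
    using subgroup.subset[OF H(1)] by blast
  ultimately have "finite H" using res_characteristic_finite by (meson inj_on_finite)
  with H show ?thesis by blast
qed

end

theorem theoremA:
  fixes G :: "('a, 'b) monoid_scheme"
  assumes "group G"
    and "solvable G"
    and "finite_rank G"
    and "finite (aut_orbits G)"
  shows "\<exists>K H. subgroup K G
           \<and> torsion_free (G\<lparr>carrier := K\<rparr>)
           \<and> radicable (G\<lparr>carrier := K\<rparr>)
           \<and> nilpotent_group (G\<lparr>carrier := K\<rparr>)
           \<and> internal_semidirect G K H
           \<and> finite H"
proof -
  obtain r where r: "fg_subgroups_generated_by G r"
    using assms(3) unfolding finite_rank_def has_rank_def by blast
  interpret group G by fact
  interpret soluble_rank_orbits G r by unfold_locales (fact assms r)+
  obtain H where H: "subgroup H G" "res \<inter> H = {\<one>\<^bsub>G\<^esub>}" "carrier G = res <#>\<^bsub>G\<^esub> H" "finite H"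
    using complement by blast
  have "torsion_free (G\<lparr>carrier := res\<rparr>)"
    unfolding torsion_free_def
  proof (intro ballI allI impI)
    fix x and n :: nat
    assume x: "x \<in> carrier (G\<lparr>carrier := res\<rparr>)"
      and n: "0 < n \<and> x [^]\<^bsub>G\<lparr>carrier := res\<rparr>\<^esub> n = \<one>\<^bsub>G\<lparr>carrier := res\<rparr>\<^esub>"
    then have "x [^]\<^bsub>G\<^esub> n \<in> {\<one>\<^bsub>G\<^esub>}" using nat_pow_consistent[of x n res] by simp
    \<comment> \<open>Torsion-freeness is \<open>res_torsion_free_mod\<close> for the trivial
      characteristic subgroup.\<close>
    then have "x \<in> {\<one>\<^bsub>G\<^esub>}" using x n res_torsion_free_mod[OF characteristic_one, of x n] by simp
    then show "x = \<one>\<^bsub>G\<lparr>carrier := res\<rparr>\<^esub>" by simp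
  qed
  moreover have "radicable (G\<lparr>carrier := res\<rparr>)"
    unfolding radicable_def using res_root nat_pow_consistent[of _ _ res] by auto
  moreover have "nilpotent_group (G\<lparr>carrier := res\<rparr>)"
    unfolding nilpotent_group_def using res_series_trivial by (simp add: lower_central_res)
  moreover have "internal_semidirect G res H"
    unfolding internal_semidirect_def using res_normal H by blast
  ultimately show ?thesis using res_subgroup H(4) by blast
qed

end
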